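(* Let $m,n\ge 1$ be relatively prime integers, and for integers $0\le s\le mn$ let $y^{[s]}(a,q;x)=\sum_{i,j,l\in\mathbb{N}}n^{[s]}_{i,j,l}a^iq^jx^l$ be the generating functions of generalized Schröder paths under the line $y=\frac{mx}{n}$ defined in the context. For $0<s<mn$ let $\alpha_s,\beta_s$ be the integers determined by $$0\le\alpha_s<n,\quad \alpha_s m\equiv s \pmod n,\qquad 0\le\beta_s<m,\quad \beta_s n\equiv s\pmod m,$$ and put $\epsilon_s:=\frac{\alpha_s m+\beta_s n-s}{mn}$ (an integer). Then $$y^{[0]}(a,q;x)=\frac{1}{1-y^{[1]}(a,q;x)},$$ $$y^{[s]}(a,q;x)=y^{[s+1]}(a,q;x)+q^{mn\epsilon_s^2-2\alpha_s\beta_s}\,x^{-\epsilon_s}\,y^{[0]}(a,q;q^{2s}x)\,y^{[\beta_s n+1]}(a,q;q^{2(s-\beta_s n)}x)\,y^{[\alpha_s m+1]}(a,q;q^{2(s-\alpha_s m)}x)\qquad (0<s<mn),$$ $$y^{[mn]}(a,q;x)=a^2q^{mn-1}x+q^{mn}x\,y^{[0]}(a,q;q^{2mn}x).$$ Moreover, the family $y^{[0]},y^{[1]},\dots,y^{[mn]}$ (as formal power series in $x$ with coefficients in $\mathbb{Z}[a,q,q^{-1}]$) is uniquely determined by these equations together with the initial values $y^{[0]}(a,q;0)=1$, $y^{[s]}(a,q;0)=0$ for $0<s<mn$, and $y^{[mn]}(a,q;0)=0$.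
   Context: $\mathbb{N}=\{0,1,2,\dots\}$. A (standard) generalized Schröder path of size $l\in\mathbb{N}$ under the line $y=\frac{mx}{n}$ is a lattice path from $(0,0)$ to $(nl,ml)$ using right steps $(1,0)$, up steps $(0,1)$ and diagonal steps $(1,1)$ that never goes above the line $y=\frac{mx}{n}$. The midway points of such a path are the lattice points visited by the path whose $x$-coordinate is not equal to $nl$ and whose $y$-coordinate is not equal to $0$. For $i,j,l,s\in\mathbb{N}$, $n^{[s]}_{i,j,l}$ is the number of generalized Schröder paths of size $l$ having exactly $\frac i2$ diagonal steps, such that the area between the path and the line $y=\frac{mx}{n}$ is $\frac j2$, and such that every midway point $(x_0,y_0)$ of the path satisfies $y_0\le\frac{mx_0-s}{n}$ (a vacuous condition if there are no midway points). By convention, $n^{[s]}_{i,j,l}=0$ whenever $s>mnl$. In particular, for $l=0$ and $s=0$ only the empty path is counted, with $i=j=0$. *)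

theory Defs
  imports
    "HOL-Analysis.Analysis"
    "HOL-Library.Poly_Mapping"
    "HOL-Library.Product_Plus"
    "HOL-Computational_Algebra.Formal_Laurent_Series"
    "HOL-Number_Theory.Cong"
begin

section \<open>Generalized Schroeder paths\<close>

text \<open>A path is encoded by its list of steps, starting at the origin.\<close>

datatype step = Right | Up | Diag

fun move :: "nat \<times> nat \<Rightarrow> step \<Rightarrow> nat \<times> nat" where
  "move (x, y) Right = (x + 1, y)"
| "move (x, y) Up = (x, y + 1)"
| "move (x, y) Diag = (x + 1, y + 1)"

fun visited_from :: "nat \<times> nat \<Rightarrow> step list \<Rightarrow> (nat \<times> nat) list" where
  "visited_from p [] = [p]"
| "visited_from p (d # ds) = p # visited_from (move p d) ds"

abbreviation visited :: "step list \<Rightarrow> (nat \<times> nat) list" where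
  "visited w \<equiv> visited_from (0, 0) w"

definition embed :: "nat \<times> nat \<Rightarrow> real \<times> real" where
  "embed p = (real (fst p), real (snd p))"

fun trace_from :: "nat \<times> nat \<Rightarrow> step list \<Rightarrow> (real \<times> real) set" where
  "trace_from p [] = {embed p}"
| "trace_from p (d # ds) =
     closed_segment (embed p) (embed (move p d)) \<union> trace_from (move p d) ds"

text \<open>The polygonal curve in the plane traced out by a path.\<close>

abbreviation trace :: "step list \<Rightarrow> (real \<times> real) set" where
  "trace w \<equiv> trace_from (0, 0) w"

definition schroeder_paths :: "nat \<Rightarrow> nat \<Rightarrow> nat \<Rightarrow> step list set" where
  "schroeder_paths m n l =
     {w. last (visited w) = (n * l, m * l) \<and>
         (\<forall>(x, y) \<in> trace w. y \<le> real m * x / real n)}"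

definition midway_points :: "nat \<Rightarrow> nat \<Rightarrow> nat \<Rightarrow> step list \<Rightarrow> (nat \<times> nat) set" where
  "midway_points m n l w = {(x, y) \<in> set (visited w). x \<noteq> n * l \<and> y \<noteq> 0}"

text \<open>The region between a path and the line consists of the vertical segments joining
  the points of the path to the line above them.\<close>

definition region_below_line :: "nat \<Rightarrow> nat \<Rightarrow> step list \<Rightarrow> (real \<times> real) set" where
  "region_below_line m n w =
     {(x, y). \<exists>y'. (x, y') \<in> trace w \<and> y' \<le> y \<and> y \<le> real m * x / real n}"

definition path_area :: "nat \<Rightarrow> nat \<Rightarrow> step list \<Rightarrow> real" where
  "path_area m n w = measure lborel (region_below_line m n w)"

definition counted_paths ::
  "nat \<Rightarrow> nat \<Rightarrow> nat \<Rightarrow> nat \<Rightarrow> nat \<Rightarrow> nat \<Rightarrow> step list set" where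
  "counted_paths m n s i j l =
     {w \<in> schroeder_paths m n l.
        real (count_list w Diag) = real i / 2 \<and>
        path_area m n w = real j / 2 \<and>
        (\<forall>(x, y) \<in> midway_points m n l w. real y \<le> (real m * real x - real s) / real n)}"

definition schroeder_number ::
  "nat \<Rightarrow> nat \<Rightarrow> nat \<Rightarrow> nat \<Rightarrow> nat \<Rightarrow> nat \<Rightarrow> nat" where
  "schroeder_number m n s i j l =
     (if s > m * n * l then 0 else card (counted_paths m n s i j l))"


section \<open>The coefficient ring and the generating functions\<close>

text \<open>The ring \<open>\<int>[a, q, q\<^sup>-\<^sup>1]\<close>, realized as the monoid ring of \<open>\<nat> \<times> \<int>\<close> over \<open>\<int>\<close>:
  the basis element indexed by \<open>(i, k)\<close> is \<open>a\<^sup>i q\<^sup>k\<close>.\<close>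

type_synonym laurent = "(nat \<times> int) \<Rightarrow>\<^sub>0 int"

definition avar :: laurent where
  "avar = Poly_Mapping.single (1, 0) 1"

definition qpow :: "int \<Rightarrow> laurent" where
  "qpow k = Poly_Mapping.single (0, k) 1"

text \<open>For fixed \<open>l\<close> only finitely many pairs \<open>(i, j)\<close> contribute, since there are only finitely
  many paths of size \<open>l\<close>; see \<open>finite_schroeder_number_support\<close> below.\<close>

definition schroeder_gf :: "nat \<Rightarrow> nat \<Rightarrow> nat \<Rightarrow> laurent fps" where
  "schroeder_gf m n s =
     Abs_fps (\<lambda>l. \<Sum>(i, j) \<in> {(i, j). schroeder_number m n s i j l \<noteq> 0}.
       of_nat (schroeder_number m n s i j l) * avar ^ i * qpow (int j))"

lemma length_le_last_visited:
  "length w + fst p + snd p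
     \<le> fst (last (visited_from p w)) + snd (last (visited_from p w))"
proof (induction w arbitrary: p)
  case Nil
  then show ?case by simp
next
  case (Cons d w)
  have ne: "visited_from q v \<noteq> []" for q v
    by (cases v) auto
  have "Suc (fst p + snd p) \<le> fst (move p d) + snd (move p d)"
    by (cases p; cases d) auto
  with Cons.IH[of "move p d"] show ?case
    by (simp add: ne)
qed

lemma finite_schroeder_paths: "finite (schroeder_paths m n l)"
proof (rule finite_subset)
  show "schroeder_paths m n l \<subseteq> {w. set w \<subseteq> {Right, Up, Diag} \<and> length w \<le> n * l + m * l}"
  proof
    fix w assume "w \<in> schroeder_paths m n l"
    then have "last (visited w) = (n * l, m * l)"
      by (simp add: schroeder_paths_def)
    with length_le_last_visited[of w "(0, 0)"] have "length w \<le> n * l + m * l"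
      by simp
    moreover have "d \<in> {Right, Up, Diag}" for d
      by (cases d) auto
    ultimately show "w \<in> {w. set w \<subseteq> {Right, Up, Diag} \<and> length w \<le> n * l + m * l}"
      by blast
  qed
  show "finite {w. set w \<subseteq> {Right, Up, Diag} \<and> length w \<le> n * l + m * l}"
    by (rule finite_lists_length_le) simp
qed

lemma finite_schroeder_number_support:
  "finite {(i, j). schroeder_number m n s i j l \<noteq> 0}"
proof (rule finite_subset)
  let ?f = "\<lambda>w. (2 * count_list w Diag, nat \<lfloor>2 * path_area m n w\<rfloor>)"
  show "{(i, j). schroeder_number m n s i j l \<noteq> 0} \<subseteq> ?f ` schroeder_paths m n l"
  proof
    fix ij assume "ij \<in> {(i, j). schroeder_number m n s i j l \<noteq> 0}"
    then obtain i j where ij: "ij = (i, j)" and nz: "schroeder_number m n s i j l \<noteq> 0"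
      by auto
    from nz have "counted_paths m n s i j l \<noteq> {}"
      by (auto simp: schroeder_number_def split: if_splits)
    then obtain w where w: "w \<in> counted_paths m n s i j l"
      by blast
    then have "real i = real (2 * count_list w Diag)" "2 * path_area m n w = real j"
      by (auto simp: counted_paths_def)
    then have "(i, j) = ?f w"
      unfolding of_nat_eq_iff by simp
    moreover from w have "w \<in> schroeder_paths m n l"
      by (simp add: counted_paths_def)
    ultimately show "ij \<in> ?f ` schroeder_paths m n l"
      using ij by blast
  qed
  show "finite (?f ` schroeder_paths m n l)"
    by (intro finite_imageI finite_schroeder_paths)
qed


section \<open>The functional equations\<close>

definition alpha :: "nat \<Rightarrow> nat \<Rightarrow> nat \<Rightarrow> nat" where
  "alpha m n s = (THE \<alpha>. \<alpha> < n \<and> [\<alpha> * m = s] (mod n))"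

definition beta :: "nat \<Rightarrow> nat \<Rightarrow> nat \<Rightarrow> nat" where
  "beta m n s = (THE \<beta>. \<beta> < m \<and> [\<beta> * n = s] (mod m))"

lemma ex1_residue:
  fixes k d s :: nat
  assumes "d \<ge> 1" "coprime k d"
  shows "\<exists>!c. c < d \<and> [c * k = s] (mod d)"
proof -
  obtain x where x: "[k * x = 1] (mod d)"
    using assms(2) cong_solve_coprime_nat by auto
  have "[x * s mod d * k = x * s * k] (mod d)"
    by (simp add: cong_def mod_mult_left_eq)
  also have "x * s * k = k * x * s" by simp
  also have "[k * x * s = 1 * s] (mod d)"
    using x by (rule cong_scalar_right)
  finally have ex: "x * s mod d < d \<and> [x * s mod d * k = s] (mod d)"
    using assms(1) by simp
  moreover have "c = c'"
    if "c < d \<and> [c * k = s] (mod d)" "c' < d \<and> [c' * k = s] (mod d)" for c c'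
  proof -
    have "[c * k = c' * k] (mod d)"
      using that cong_trans cong_sym by blast
    then have "[c = c'] (mod d)"
      using assms(2) by (simp add: cong_mult_rcancel_nat coprime_commute)
    then show "c = c'"
      using that by (simp add: cong_less_modulus_unique_nat)
  qed
  ultimately show ?thesis by blast
qed

definition epsilon_num :: "nat \<Rightarrow> nat \<Rightarrow> nat \<Rightarrow> int" where
  "epsilon_num m n s = int (alpha m n s * m) + int (beta m n s * n) - int s"

text \<open>The division is exact when \<open>m\<close> and \<open>n\<close> are coprime and positive.\<close>

definition epsilon :: "nat \<Rightarrow> nat \<Rightarrow> nat \<Rightarrow> int" where
  "epsilon m n s = epsilon_num m n s div int (m * n)"

text \<open>\<open>qsubst k f\<close> is \<open>f(a, q; q\<^sup>k x)\<close>.\<close>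

definition qsubst :: "int \<Rightarrow> laurent fps \<Rightarrow> laurent fps" where
  "qsubst k f = f oo (fps_const (qpow k) * fps_X)"

text \<open>The equation \<open>Y\<^sub>0 = 1 / (1 - Y\<^sub>1)\<close> says that \<open>Y\<^sub>0\<close> is the multiplicative inverse of
  \<open>1 - Y\<^sub>1\<close> (the coefficient ring is not a field). Because of the factor
  \<open>x\<^sup>-\<^sup>\<epsilon>\<close>, the second family of equations is read in the ring of formal
  Laurent series in \<open>x\<close>.\<close>

definition schroeder_equations :: "nat \<Rightarrow> nat \<Rightarrow> (nat \<Rightarrow> laurent fps) \<Rightarrow> bool" where
  "schroeder_equations m n Y \<longleftrightarrow>
     Y 0 * (1 - Y 1) = 1 \<and>
     (\<forall>s. 0 < s \<and> s < m * n \<longrightarrow>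
        (let \<alpha> = alpha m n s; \<beta> = beta m n s; \<epsilon> = epsilon m n s in
         fps_to_fls (Y s) =
           fps_to_fls (Y (s + 1)) +
           fls_const (qpow (int (m * n) * \<epsilon>\<^sup>2 - 2 * int \<alpha> * int \<beta>)) * fls_X_intpow (- \<epsilon>) *
           fps_to_fls (qsubst (2 * int s) (Y 0)) *
           fps_to_fls (qsubst (2 * (int s - int (\<beta> * n))) (Y (\<beta> * n + 1))) *
           fps_to_fls (qsubst (2 * (int s - int (\<alpha> * m))) (Y (\<alpha> * m + 1))))) \<and>
     Y (m * n) =
       fps_const (avar\<^sup>2 * qpow (int (m * n) - 1)) * fps_X +
       fps_const (qpow (int (m * n))) * fps_X * qsubst (2 * int (m * n)) (Y 0)"

definition schroeder_initial :: "nat \<Rightarrow> nat \<Rightarrow> (nat \<Rightarrow> laurent fps) \<Rightarrow> bool" where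
  "schroeder_initial m n Y \<longleftrightarrow>
     fps_nth (Y 0) 0 = 1 \<and>
     (\<forall>s. 0 < s \<and> s < m * n \<longrightarrow> fps_nth (Y s) 0 = 0) \<and>
     fps_nth (Y (m * n)) 0 = 0"

end

theory Submission
  imports Defs
begin

text \<open>A path is a word in the three steps, and everything that is counted about it is additive or
  nearly additive under concatenation of words. Besides \<open>width\<close> and \<open>height\<close>, there are two statistics:

  \<^item> the \<open>level\<close> \<open>m \<cdot> width - n \<cdot> height\<close> of a word, which measures how far below the line its end point
    lies. Midway points have to lie at level at least \<open>s\<close>, other points at level at least 0.
  \<^item> the \<open>sweep\<close>, twice the signed area between the word and the chord joining its end points. It is
    the sum of the cross products of all pairs of steps in their order, so \<open>sweep (u @ v)\<close> differs
    from \<open>sweep u + sweep v\<close> by the cross product of the displacements of \<open>u\<close> and \<open>v\<close>. For a path under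
    the line the chord is the line itself, so that \<open>sweep\<close> is the exponent of \<open>q\<close>
    (lemma \<open>path_area_sweep\<close>, by Fubini for each step).

  The equation for \<open>y\<^sup>[\<^sup>0\<^sup>]\<close> is the decomposition of a path at its first return to the
  line. For \<open>y\<^sup>[\<^sup>m\<^sup>n\<^sup>]\<close>, all midway points lie on or below the parallel through
  \<open>(n, 0)\<close>, so the path is \<open>Right\<^sup>n v Up\<^sup>m\<close> with \<open>v\<close> an arbitrary
  path under that shifted line; for size 1 it may also cut the corner with a diagonal step.

  For \<open>0 < s < mn\<close>, the difference \<open>y\<^sup>[\<^sup>s\<^sup>] -
  y\<^sup>[\<^sup>s\<^sup>+\<^sup>1\<^sup>]\<close> counts the paths with a midway point at level exactly
  \<open>s\<close>. Such a path is cut at the first and at the last of these contacts into \<open>u\<close>,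
  \<open>v\<close> and \<open>z\<close>. The middle part \<open>v\<close> is a path under a line, giving
  \<open>y\<^sup>[\<^sup>0\<^sup>]\<close>. The part \<open>u\<close> is a \<open>first_passage\<close>: it ends at
  level \<open>s\<close> and before that stays at higher levels once it has left the base line. Because it starts with
  a long run of right steps, adding or removing some of them moves its end to any other level \<open>\<ge> 0\<close>
  congruent to \<open>s\<close> modulo \<open>m\<close>, in particular to \<open>\<beta>n\<close>, and then appending
  \<open>\<beta>\<close> up steps yields a path counted by
  \<open>y\<^sup>[\<^sup>\<beta>\<^sup>n\<^sup>+\<^sup>1\<^sup>]\<close>; every path counted there ends with at least
  \<open>\<beta>\<close> up steps. Reflection in the antidiagonal exchanges \<open>m\<close> and \<open>n\<close> and
  turns last passages into first passages, which handles \<open>z\<close>. The powers of \<open>q\<close> then come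
  out of the concatenation rule for \<open>sweep\<close> as one polynomial identity (lemma
  \<open>path_sum_touching\<close>).

  For uniqueness, the coefficients of \<open>x\<^sup>l\<close> are determined by induction on \<open>l\<close> and,
  for fixed \<open>l\<close>, by descending induction on \<open>s\<close>. Since \<open>\<epsilon>\<close> is 0 or 1
  and the last two factors have no constant term, coefficients of order \<open>l\<close> occur in the product only for
  \<open>\<epsilon> = 1\<close>, and then \<open>\<beta>n\<close> and \<open>\<alpha>m\<close> are both greater than
  \<open>s\<close>.\<close>

section \<open>Words and their signed area\<close>

primrec east :: "step \<Rightarrow> int" where
  "east Right = 1" | "east Up = 0" | "east Diag = 1"

primrec north :: "step \<Rightarrow> int" where
  "north Right = 0" | "north Up = 1" | "north Diag = 1"

primrec width :: "step list \<Rightarrow> int" where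
  "width [] = 0" | "width (d # w) = east d + width w"

primrec height :: "step list \<Rightarrow> int" where
  "height [] = 0" | "height (d # w) = north d + height w"

text \<open>The cross products of the first step with all later ones are collected at once, as the cross product
  with their sum.\<close>

primrec sweep :: "step list \<Rightarrow> int" where
  "sweep [] = 0"
| "sweep (d # w) = sweep w + east d * height w - north d * width w"

text \<open>A positive value means that the end point lies strictly below the line of slope \<open>m / n\<close> through the
  start; all points at one level lie on one parallel of that line.\<close>

definition level :: "nat \<Rightarrow> nat \<Rightarrow> step list \<Rightarrow> int" where
  "level m n w = int m * width w - int n * height w"

definition wt :: "step list \<Rightarrow> laurent" where
  "wt w = avar ^ (2 * count_list w Diag) * qpow (sweep w)"

lemma width_append [simp]: "width (u @ v) = width u + width v"
  by (induction u) auto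

lemma height_append [simp]: "height (u @ v) = height u + height v"
  by (induction u) auto

lemma sweep_append [simp]:
  "sweep (u @ v) = sweep u + sweep v + width u * height v - height u * width v"
  by (induction u) (auto simp: algebra_simps)

lemma level_Nil [simp]: "level m n [] = 0"
  by (simp add: level_def)

lemma level_append [simp]: "level m n (u @ v) = level m n u + level m n v"
  by (simp add: level_def algebra_simps)

lemma width_nonneg: "0 \<le> width w"
proof (induction w)
  case (Cons d w) then show ?case by (cases d) auto
qed auto

lemma height_nonneg: "0 \<le> height w"
proof (induction w)
  case (Cons d w) then show ?case by (cases d) auto
qed auto

lemma length_le_width_height: "int (length w) \<le> width w + height w"
proof (induction w)
  case (Cons d w) then show ?case by (cases d) auto
qed auto

lemma width_height_pos: "w \<noteq> [] \<Longrightarrow> 0 < width w + height w"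
  using length_le_width_height[of w] by (cases w) auto

lemma width_replicate [simp]: "width (replicate k d) = int k * east d"
  by (induction k) (auto simp: algebra_simps)

lemma height_replicate [simp]: "height (replicate k d) = int k * north d"
  by (induction k) (auto simp: algebra_simps)

lemma sweep_replicate [simp]: "sweep (replicate k d) = 0"
  by (induction k) (auto simp: algebra_simps)

lemma count_list_replicate_Diag [simp]:
  "d \<noteq> Diag \<Longrightarrow> count_list (replicate k d) Diag = 0"
  by (induction k) auto

lemma finite_words: "finite {w. width w \<le> x \<and> height w \<le> y}"
proof (rule finite_subset)
  show "{w. width w \<le> x \<and> height w \<le> y}
      \<subseteq> {w. set w \<subseteq> {Right, Up, Diag} \<and> length w \<le> nat (x + y)}"
  proof
    fix w assume "w \<in> {w. width w \<le> x \<and> height w \<le> y}"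
    then have "length w \<le> nat (x + y)"
      using length_le_width_height[of w] by auto
    moreover have "d \<in> {Right, Up, Diag}" for d
      by (cases d) auto
    ultimately show "w \<in> {w. set w \<subseteq> {Right, Up, Diag} \<and> length w \<le> nat (x + y)}"
      by blast
  qed
  show "finite {w. set w \<subseteq> {Right, Up, Diag} \<and> length w \<le> nat (x + y)}"
    by (rule finite_lists_length_le) simp
qed

text \<open>Used with \<open>d = Right\<close> and \<open>d = Up\<close> to locate the first step that leaves an axis.\<close>

lemma leading_steps:
  obtains i r where "w = replicate i d @ r" "r = [] \<or> (\<exists>e r'. r = e # r' \<and> e \<noteq> d)"
proof -
  have "\<exists>i r. w = replicate i d @ r \<and> (r = [] \<or> (\<exists>e r'. r = e # r' \<and> e \<noteq> d))"
  proof (induction w)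
    case Nil
    show ?case by (rule exI[of _ 0]) auto
  next
    case (Cons c w)
    then obtain i r where ir: "w = replicate i d @ r" "r = [] \<or> (\<exists>e r'. r = e # r' \<and> e \<noteq> d)"
      by blast
    show ?case
    proof (cases "c = d")
      case True
      then show ?thesis using ir by (intro exI[of _ "Suc i"] exI[of _ r]) auto
    next
      case False
      then show ?thesis by (intro exI[of _ 0] exI[of _ "c # w"]) auto
    qed
  qed
  then show ?thesis using that by blast
qed

text \<open>A cut of \<open>u @ v\<close> falls strictly inside \<open>u\<close>, or at the joint or later; the joint belongs to the second case.\<close>

lemma split_append_cases:
  assumes "u @ v = p @ r"
  obtains (left) c where "u = p @ c" "c \<noteq> []" "r = c @ v"
  | (right) c where "p = u @ c" "v = c @ r"
proof -
  from assms obtain c where "u = p @ c \<and> c @ v = r \<or> u @ c = p \<and> v = c @ r"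
    unfolding append_eq_append_conv2 by blast
  then show ?thesis
    using left[of c] right[of c] right[of "[]"] by (cases "c = []") auto
qed

section \<open>Reflection in the antidiagonal\<close>

primrec flip :: "step \<Rightarrow> step" where
  "flip Right = Up" | "flip Up = Right" | "flip Diag = Diag"

text \<open>The reflection \<open>(x, y) \<mapsto> (- y, - x)\<close> of the plane, with the direction of travel reversed. Exchanging the
  coordinates and reversing the order each negate all cross products, so \<open>sweep\<close> is kept.\<close>

definition reflect :: "step list \<Rightarrow> step list" where
  "reflect w = rev (map flip w)"

lemma flip_flip [simp]: "flip (flip d) = d"
  by (cases d) auto

lemma reflect_Nil [simp]: "reflect [] = []"
  by (simp add: reflect_def)

lemma reflect_append [simp]: "reflect (u @ v) = reflect v @ reflect u"
  by (simp add: reflect_def)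

lemma reflect_reflect [simp]: "reflect (reflect w) = w"
  by (simp add: reflect_def rev_map comp_def)

lemma reflect_eq_Nil_iff [simp]: "reflect w = [] \<longleftrightarrow> w = []"
  by (simp add: reflect_def)

lemma reflect_Cons: "reflect (d # w) = reflect w @ [flip d]"
  by (simp add: reflect_def)

lemma reflect_replicate [simp]: "reflect (replicate k d) = replicate k (flip d)"
  by (simp add: reflect_def)

lemma width_reflect [simp]: "width (reflect w) = height w"
proof (induction w)
  case (Cons d w) then show ?case by (cases d) (auto simp: reflect_Cons)
qed auto

lemma height_reflect [simp]: "height (reflect w) = width w"
proof (induction w)
  case (Cons d w) then show ?case by (cases d) (auto simp: reflect_Cons)
qed auto

lemma sweep_reflect [simp]: "sweep (reflect w) = sweep w"
proof (induction w)
  case (Cons d w) then show ?case by (cases d) (auto simp: reflect_Cons)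
qed auto

lemma count_reflect [simp]: "count_list (reflect w) Diag = count_list w Diag"
proof (induction w)
  case (Cons d w) then show ?case by (cases d) (auto simp: reflect_Cons)
qed auto

lemma wt_reflect [simp]: "wt (reflect w) = wt w"
  by (simp add: wt_def)

lemma level_reflect [simp]: "level n m (reflect w) = - level m n w"
  by (simp add: level_def)

lemma inj_reflect: "inj_on reflect A"
  by (rule inj_on_inverseI[of _ reflect]) simp

lemma reflect_split: "reflect w = p @ r \<longleftrightarrow> w = reflect r @ reflect p"
proof
  assume "reflect w = p @ r"
  then have "reflect (reflect w) = reflect (p @ r)" by (rule arg_cong)
  then show "w = reflect r @ reflect p" by simp
qed simp

section \<open>Admissible paths, first passages and last passages\<close>

text \<open>The parameter \<open>s\<close> is an integer, so that levels can be shifted freely. No bound on \<open>s\<close> in terms of \<open>l\<close> is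
  built in; it enters in \<open>path_sum\<close>.\<close>

definition paths :: "nat \<Rightarrow> nat \<Rightarrow> int \<Rightarrow> nat \<Rightarrow> step list set" where
  "paths m n s l = {w. width w = int (n * l) \<and> height w = int (m * l) \<and>
     (\<forall>p r. w = p @ r \<longrightarrow> 0 \<le> level m n p \<and>
       (width p \<noteq> int (n * l) \<and> height p \<noteq> 0 \<longrightarrow> s \<le> level m n p))}"

text \<open>Prefixes on the base line are exempt, just as points with \<open>y = 0\<close> are no midway points. The width of
  such a word is determined by \<open>s\<close> and \<open>y\<close>.\<close>

definition first_passage :: "nat \<Rightarrow> nat \<Rightarrow> int \<Rightarrow> int \<Rightarrow> step list set" where
  "first_passage m n s y = {u. level m n u = s \<and> height u = y \<and> 1 \<le> y \<and>
     (\<forall>p r. u = p @ r \<and> r \<noteq> [] \<and> height p \<noteq> 0 \<longrightarrow> s < level m n p)}"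

text \<open>The condition concerns the points after the start of \<open>z\<close>, which itself lies at level \<open>s\<close> of the whole path;
  points in the last column, where \<open>width r = 0\<close>, are exempt.\<close>

definition last_passage :: "nat \<Rightarrow> nat \<Rightarrow> int \<Rightarrow> int \<Rightarrow> step list set" where
  "last_passage m n s x = {z. level m n z = - s \<and> width z = x \<and> 1 \<le> x \<and>
     (\<forall>p r. z = p @ r \<and> p \<noteq> [] \<and> width r \<noteq> 0 \<longrightarrow> 0 < level m n p)}"

lemma finite_paths: "finite (paths m n s l)"
  by (rule finite_subset[OF _ finite_words[of "int (n * l)" "int (m * l)"]])
    (auto simp: paths_def)

lemma last_passage_reflect: "last_passage m n s x = reflect ` first_passage n m s x"
proof -
  have "reflect z \<in> first_passage n m s x \<longleftrightarrow> z \<in> last_passage m n s x" for z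
  proof -
    have *: "(\<forall>p r. reflect z = p @ r \<and> r \<noteq> [] \<and> height p \<noteq> 0 \<longrightarrow> s < level n m p) \<longleftrightarrow>
      (\<forall>p r. z = p @ r \<and> p \<noteq> [] \<and> width r \<noteq> 0 \<longrightarrow> 0 < level m n p)" (is "?L \<longleftrightarrow> ?R")
      if "level m n z = - s"
    proof
      assume L: ?L
      show ?R
      proof (intro allI impI)
        fix p r assume "z = p @ r \<and> p \<noteq> [] \<and> width r \<noteq> 0"
        then show "0 < level m n p" using L[rule_format, of "reflect r" "reflect p"] that by simp
      qed
    next
      assume R: ?R
      show ?L
      proof (intro allI impI)
        fix p r assume "reflect z = p @ r \<and> r \<noteq> [] \<and> height p \<noteq> 0"
        then show "s < level n m p"
          using R[rule_format, of "reflect r" "reflect p"] that level_reflect[of m n p]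
          by (simp add: reflect_split)
      qed
    qed
    show ?thesis
    proof (cases "level m n z = - s")
      case True
      then show ?thesis
        unfolding first_passage_def last_passage_def mem_Collect_eq *[OF True] by simp
    next
      case False
      then show ?thesis by (auto simp: first_passage_def last_passage_def)
    qed
  qed
  then have "z \<in> last_passage m n s x \<longleftrightarrow> reflect z \<in> first_passage n m s x" for z
    by blast
  moreover have "z \<in> reflect ` F \<longleftrightarrow> reflect z \<in> F" for z F
    by (auto intro: image_eqI[of z reflect "reflect z"])
  ultimately show ?thesis by blast
qed

lemma finite_first_passage:
  assumes "m \<ge> 1"
  shows "finite (first_passage m n s y)"
proof (rule finite_subset[OF _ finite_words[of "s + int n * y" y]])
  have "width u \<le> s + int n * y" if "level m n u = s" "height u = y" for u
  proof -
    have "1 * width u \<le> int m * width u" using assms by (intro mult_right_mono) (auto simp: width_nonneg)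
    then show ?thesis using that by (simp add: level_def)
  qed
  then show "first_passage m n s y \<subseteq> {w. width w \<le> s + int n * y \<and> height w \<le> y}"
    by (auto simp: first_passage_def)
qed

lemma paths_reflect: "paths m n s l = reflect ` paths n m s l"
proof -
  have imp: "reflect w \<in> paths n m s l" if w: "w \<in> paths m n s l" for m n w
    unfolding paths_def mem_Collect_eq
  proof (intro conjI allI impI)
    show "width (reflect w) = int (m * l)" "height (reflect w) = int (n * l)"
      using w by (auto simp: paths_def)
    fix p r assume "reflect w = p @ r"
    then have eq: "w = reflect r @ reflect p" by (simp add: reflect_split)
    have tot: "level m n w = 0" using w by (simp add: paths_def level_def)
    have *: "0 \<le> level m n (reflect r) \<and>
       (width (reflect r) \<noteq> int (n * l) \<and> height (reflect r) \<noteq> 0 \<longrightarrow> s \<le> level m n (reflect r))"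
      using w eq unfolding paths_def by blast
    have lev: "level m n (reflect r) = level n m p"
      using tot level_reflect[of m n p] level_reflect[of n m p] unfolding eq
      by simp
    show "0 \<le> level n m p" using * lev by simp
    assume "width p \<noteq> int (m * l) \<and> height p \<noteq> 0"
    moreover have "height w = width r + width p" "width w = height r + height p"
      unfolding eq by simp_all
    ultimately have "width (reflect r) \<noteq> int (n * l) \<and> height (reflect r) \<noteq> 0"
      using w by (auto simp: paths_def)
    then show "s \<le> level n m p" using * lev by simp
  qed
  show ?thesis
  proof
    show "paths m n s l \<subseteq> reflect ` paths n m s l"
    proof
      fix w assume "w \<in> paths m n s l"
      then show "w \<in> reflect ` paths n m s l"
        using imp reflect_reflect by (metis image_eqI)
    qed
    show "reflect ` paths n m s l \<subseteq> paths m n s l" using imp by blast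
  qed
qed

section \<open>Shifting a first passage\<close>

lemma level_nonneg_on_base: "height p = 0 \<Longrightarrow> 0 \<le> level m n p"
  by (simp add: level_def width_nonneg)

text \<open>The first point off the base line already lies at level at least \<open>s + m K\<close>, and an additional step to the
  right raises the level by only \<open>m\<close>; hence a first passage to level \<open>s + m K\<close> begins with at least \<open>K\<close> right
  steps, and these can be stripped off.\<close>

lemma first_passage_Right_shift:
  assumes n: "n \<ge> 1" and s: "0 \<le> s"
  shows "first_passage m n (s + int m * int K) y = (\<lambda>u. replicate K Right @ u) ` first_passage m n s y"
    (is "?L = ?f ` ?R")
proof
  show "?f ` ?R \<subseteq> ?L"
  proof
    fix w assume "w \<in> ?f ` ?R"
    then obtain u where w: "w = replicate K Right @ u" and u: "u \<in> first_passage m n s y" by blast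
    have "s + int m * int K < level m n p"
      if eq: "w = p @ r" and "r \<noteq> []" "height p \<noteq> 0" for p r
    proof -
      from eq w have "replicate K Right @ u = p @ r" by simp
      then show ?thesis
      proof (cases rule: split_append_cases)
        case (left c)
        have "height p + height c = 0" using arg_cong[OF left(1), of height] by simp
        then show ?thesis using \<open>height p \<noteq> 0\<close> height_nonneg[of p] height_nonneg[of c] by linarith
      next
        case (right c)
        then have "height c \<noteq> 0" using that by simp
        then have "s < level m n c"
          using u right \<open>r \<noteq> []\<close> unfolding first_passage_def mem_Collect_eq by blast
        then show ?thesis using right by (simp add: level_def algebra_simps)
      qed
    qed
    then show "w \<in> ?L" using u by (auto simp: first_passage_def w level_def algebra_simps)
  qed
  show "?L \<subseteq> ?f ` ?R"
  proof
    fix w assume w: "w \<in> ?L"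
    obtain i r where ir: "w = replicate i Right @ r" "r = [] \<or> (\<exists>e r'. r = e # r' \<and> e \<noteq> Right)"
      using leading_steps[of w Right] by blast
    have "r \<noteq> []" using w ir by (auto simp: first_passage_def)
    then obtain e r' where r: "r = e # r'" "e \<noteq> Right" using ir by blast
    let ?p = "replicate i Right @ [e]"
    have eq: "w = ?p @ r'" using ir r by simp
    have "north e = 1" using r by (cases e) auto
    then have hp: "height ?p = 1" by simp
    have "s + int m * int K \<le> level m n ?p"
    proof (cases "r' = []")
      case True
      then show ?thesis using w eq by (simp add: first_passage_def)
    next
      case False
      then have "s + int m * int K < level m n ?p"
        using w eq hp unfolding first_passage_def mem_Collect_eq by (metis zero_neq_one)
      then show ?thesis by simp
    qed
    then have "int m * int K < int m * (int i + east e)"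
      using hp s n by (simp add: level_def algebra_simps)
    then have "int K < int i + east e" by (simp add: mult_less_cancel_left)
    moreover have "east e \<le> 1" by (cases e) auto
    ultimately have "K \<le> i" by linarith
    define u where "u = replicate (i - K) Right @ r"
    have wu: "w = replicate K Right @ u"
      using ir \<open>K \<le> i\<close> by (simp add: u_def flip: append_assoc replicate_add)
    have "s < level m n p" if "u = p @ q" "q \<noteq> []" "height p \<noteq> 0" for p q
    proof -
      have "w = (replicate K Right @ p) @ q" using wu that by simp
      moreover have "height (replicate K Right @ p) \<noteq> 0" using that by simp
      ultimately have "s + int m * int K < level m n (replicate K Right @ p)"
        using w that(2) unfolding first_passage_def mem_Collect_eq by blast
      then show ?thesis by (simp add: level_def algebra_simps)
    qed
    then have "u \<in> ?R" using w by (auto simp: first_passage_def wu level_def algebra_simps)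
    then show "w \<in> ?f ` ?R" using wu by blast
  qed
qed

text \<open>A path whose midway points all lie above level \<open>b n\<close> enters its last column at level at least
  \<open>b n\<close>: otherwise the last point before that column would be a midway point of level below \<open>b n\<close>. So the path ends with at least \<open>b\<close> up
  steps, and the point before the last \<open>b\<close> of them has level exactly \<open>b n\<close>.\<close>

lemma paths_eq_first_passage_Ups:
  assumes m: "m \<ge> 1" and l: "l \<ge> 1" and b: "b < m" and n: "n \<ge> 1"
  shows "paths m n (int (b * n) + 1) l
    = (\<lambda>u. u @ replicate b Up) ` first_passage m n (int (b * n)) (int (m * l) - int b)"
    (is "?L = ?f ` ?R")
proof
  have pos: "1 \<le> int (m * l) - int b"
  proof -
    have "m * 1 \<le> m * l" using l by (intro mult_le_mono) auto
    then show ?thesis using b by linarith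
  qed
  have wid: "width u = int (n * l)" if "level m n u = int (b * n)" "height u = int (m * l) - int b" for u
  proof -
    have "int m * width u = int m * int (n * l)"
      using that by (simp add: level_def algebra_simps)
    then show ?thesis using m by simp
  qed
  show "?f ` ?R \<subseteq> ?L"
  proof
    fix w assume "w \<in> ?f ` ?R"
    then obtain u where w: "w = u @ replicate b Up"
      and u: "u \<in> first_passage m n (int (b * n)) (int (m * l) - int b)" by blast
    have wu: "width u = int (n * l)" and hu: "height u = int (m * l) - int b"
      using wid u by (auto simp: first_passage_def)
    have "0 \<le> level m n p \<and>
       (width p \<noteq> int (n * l) \<and> height p \<noteq> 0 \<longrightarrow> int (b * n) + 1 \<le> level m n p)"
      if eq: "w = p @ r" for p r
    proof -
      from eq w have "u @ replicate b Up = p @ r" by simp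
      then show ?thesis
      proof (cases rule: split_append_cases)
        case (left c)
        then have *: "height p = 0 \<or> int (b * n) < level m n p"
          using u unfolding first_passage_def mem_Collect_eq by blast
        moreover have "0 \<le> level m n p"
          using * level_nonneg_on_base[of p m n] of_nat_0_le_iff[of "b * n"] by linarith
        ultimately show ?thesis by auto
      next
        case (right c)
        have "width c + width r = 0" "height c + height r = int b"
          using arg_cong[OF right(2), of width] arg_cong[OF right(2), of height] by simp_all
        then have "width c = 0" and c: "height c \<le> int b"
          using width_nonneg[of c] width_nonneg[of r] height_nonneg[of r] by linarith+
        have "level m n p = int n * (int b - height c)"
          using right u \<open>width c = 0\<close> by (simp add: first_passage_def level_def algebra_simps)
        then have "0 \<le> level m n p" using c by simp
        moreover have "width p = int (n * l)" using right wu \<open>width c = 0\<close> by simp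
        ultimately show ?thesis by simp
      qed
    qed
    then show "w \<in> ?L" using wu hu by (auto simp: paths_def w)
  qed
  show "?L \<subseteq> ?f ` ?R"
  proof
    fix w assume w: "w \<in> ?L"
    obtain i r where ir: "reflect w = replicate i Right @ r" "r = [] \<or> (\<exists>e r'. r = e # r' \<and> e \<noteq> Right)"
      using leading_steps[of "reflect w" Right] by blast
    have ww: "width w = int (n * l)" and hw: "height w = int (m * l)" using w by (auto simp: paths_def)
    have "r \<noteq> []"
    proof
      assume "r = []"
      then have "height (reflect w) = 0" using ir by simp
      then show False using ww n l by simp
    qed
    then obtain e r' where r: "r = e # r'" "e \<noteq> Right" using ir by blast
    have w1: "w = reflect r' @ flip e # replicate i Up"
      using ir(1) r unfolding reflect_split by (simp add: reflect_Cons)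
    have fe: "east (flip e) = 1" using r by (cases e) auto
    have "b \<le> i"
    proof (rule ccontr)
      assume "\<not> b \<le> i"
      have p: "0 \<le> level m n p \<and>
       (width p \<noteq> int (n * l) \<and> height p \<noteq> 0 \<longrightarrow> int (b * n) + 1 \<le> level m n p)"
        if "p = reflect r'" for p
        using w w1 that unfolding paths_def mem_Collect_eq by blast
      have wp: "width (reflect r') = int (n * l) - 1" using ww w1 fe by simp
      have hp: "height (reflect r') = int (m * l) - int i - north (flip e)" using hw w1 by simp
      have ne: "north (flip e) \<le> 1" by (cases e) auto
      have nb: "int i + north (flip e) \<le> int b" using \<open>\<not> b \<le> i\<close> ne by linarith
      then have "height (reflect r') \<noteq> 0" using hp pos by linarith
      then have "int (b * n) + 1 \<le> level m n (reflect r')" using p wp by simp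
      also have "level m n (reflect r') = int n * (int i + north (flip e)) - int m"
        unfolding level_def wp hp by (simp add: algebra_simps)
      also have "\<dots> \<le> int n * int b - int m" using nb by (simp add: mult_left_mono)
      finally show False by simp
    qed
    define u where "u = reflect r' @ flip e # replicate (i - b) Up"
    have wu: "w = u @ replicate b Up"
      using w1 \<open>b \<le> i\<close> by (simp add: u_def flip: replicate_add)
    have hu: "height u = int (m * l) - int b" and widu: "width u = int (n * l)"
      using hw ww wu by auto
    have "int (b * n) < level m n p" if eq: "u = p @ q" and "q \<noteq> []" "height p \<noteq> 0" for p q
    proof (cases "width p = int (n * l)")
      case True
      then have "width q = 0" using widu eq by simp
      then have "height q \<ge> 1" using width_height_pos[OF \<open>q \<noteq> []\<close>] by linarith
      then have "int n * (int b + 1) \<le> int n * (int b + height q)" by (intro mult_left_mono) auto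
      also have "\<dots> = level m n p"
      proof -
        have hp: "height p = int (m * l) - int b - height q" using hu eq by simp
        show ?thesis unfolding level_def hp True by (simp add: algebra_simps)
      qed
      finally show ?thesis using n by (simp add: algebra_simps)
    next
      case False
      have "w = p @ q @ replicate b Up" using wu eq by simp
      then have "int (b * n) + 1 \<le> level m n p"
        using w False \<open>height p \<noteq> 0\<close> unfolding paths_def mem_Collect_eq by blast
      then show ?thesis by simp
    qed
    moreover have "level m n u = int (b * n)"
      unfolding level_def hu widu by (simp add: algebra_simps)
    ultimately have "u \<in> ?R"
      using hu pos by (auto simp: first_passage_def)
    then show "w \<in> ?f ` ?R" using wu by blast
  qed
qed

section \<open>Cutting a path at its contacts with a parallel line\<close>

lemma level_zero_multiple:
  assumes m: "m \<ge> 1" and n: "n \<ge> 1" and co: "coprime m n" and "level m n v = 0"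
  obtains t where "width v = int (n * t)" "height v = int (m * t)"
proof -
  have eq: "int m * width v = int n * height v" using assms by (simp add: level_def)
  then have "int n dvd int m * width v" by simp
  then have "int n dvd width v" using co
    by (simp add: coprime_dvd_mult_right_iff coprime_commute)
  then obtain k where k: "width v = int n * k" by blast
  have "0 \<le> int n * k" using width_nonneg[of v] k by simp
  then have "0 \<le> k" using n by (simp add: zero_le_mult_iff)
  then obtain t where t: "k = int t" using nonneg_int_cases by blast
  have "int n * height v = int m * (int n * int t)" using eq unfolding k t by (rule sym)
  also have "\<dots> = int n * int (m * t)" by (simp add: algebra_simps)
  finally have "int n * height v = int n * int (m * t)" .
  moreover have "int n \<noteq> 0" using n by simp
  ultimately have "height v = int (m * t)" using mult_left_cancel by blast
  moreover have "width v = int (n * t)" using k t by simp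
  ultimately show ?thesis using that by blast
qed

text \<open>The path is cut at its first and its last midway point of level \<open>s\<close>; such a point exists because
  otherwise all midway points would have level at least \<open>s + 1\<close>.\<close>

lemma touching_decompose:
  assumes s: "0 < s" and w: "w \<in> paths m n s l" and nw: "w \<notin> paths m n (s + 1) l"
  obtains u v z where "w = u @ v @ z" "u \<in> first_passage m n s (height u)"
    "level m n v = 0" "\<And>p r. v = p @ r \<Longrightarrow> 0 \<le> level m n p"
    "z \<in> last_passage m n s (width z)"
proof -
  have ww: "width w = int (n * l)" and hw: "height w = int (m * l)"
    and wp: "\<And>p r. w = p @ r \<Longrightarrow> 0 \<le> level m n p \<and>
       (width p \<noteq> int (n * l) \<and> height p \<noteq> 0 \<longrightarrow> s \<le> level m n p)"
    using w by (auto simp: paths_def)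
  \<comment> \<open>\<open>Q k\<close>: the point after \<open>k\<close> steps is a midway point of level exactly \<open>s\<close>.\<close>
  define Q where "Q k \<longleftrightarrow> k \<le> length w \<and> width (take k w) \<noteq> int (n * l) \<and> height (take k w) \<noteq> 0
    \<and> level m n (take k w) = s" for k
  have "\<exists>p r. w = p @ r \<and> width p \<noteq> int (n * l) \<and> height p \<noteq> 0 \<and> \<not> s + 1 \<le> level m n p"
    using nw ww hw wp unfolding paths_def mem_Collect_eq by blast
  then obtain p r where pr: "w = p @ r" "width p \<noteq> int (n * l)" "height p \<noteq> 0" "\<not> s + 1 \<le> level m n p"
    by blast
  have "s \<le> level m n p" using wp[OF pr(1)] pr by simp
  then have "Q (length p)" using pr by (auto simp: Q_def)
  define i where "i = (LEAST k. Q k)"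
  define j where "j = (GREATEST k. Q k)"
  have Qi: "Q i" unfolding i_def using \<open>Q (length p)\<close> by (rule LeastI)
  have Qj: "Q j" unfolding j_def
    by (rule GreatestI_nat[where b = "length w"]) (use \<open>Q (length p)\<close> in \<open>auto simp: Q_def\<close>)
  have imin: "i \<le> k" if "Q k" for k unfolding i_def using that by (rule Least_le)
  have jmax: "k \<le> j" if "Q k" for k unfolding j_def
    by (rule Greatest_le_nat[where b = "length w"]) (use that in \<open>auto simp: Q_def\<close>)
  have ij: "i \<le> j" using imin[OF Qj] .
  define u where "u = take i w"
  define v where "v = drop i (take j w)"
  define z where "z = drop j w"
  have uv: "take j w = u @ v" unfolding u_def v_def
    using append_take_drop_id[of i "take j w"] ij by (simp add: min_def)
  have wuvz: "w = u @ v @ z" using append_take_drop_id[of j w] uv by (simp add: z_def)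
  have lu: "level m n u = s" "width u \<noteq> int (n * l)" "height u \<noteq> 0"
    using Qi by (auto simp: Q_def u_def)
  have luv: "level m n (u @ v) = s" "width (u @ v) \<noteq> int (n * l)"
    using Qj by (auto simp: Q_def uv)
  have wuv: "width (u @ v) < int (n * l)"
    using luv ww width_nonneg[of z] unfolding wuvz width_append by linarith
  have hu: "1 \<le> height u" using lu height_nonneg[of u] by linarith
  have strict: "s + 1 \<le> level m n p"
    if "w = p @ r" "width p \<noteq> int (n * l)" "height p \<noteq> 0" "\<not> Q (length p)" for p r
  proof -
    have "s \<le> level m n p" using wp[OF that(1)] that by blast
    moreover have "level m n p \<noteq> s" using that by (auto simp: Q_def)
    ultimately show ?thesis by simp
  qed
  have "s < level m n p" if eq: "u = p @ r" and r: "r \<noteq> []" and hp: "height p \<noteq> 0" for p r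
  proof -
    have "\<not> Q (length p)"
    proof
      assume "Q (length p)"
      then have "i \<le> length p" by (rule imin)
      moreover have "length u \<le> i" by (simp add: u_def)
      ultimately show False using eq r by (cases r) auto
    qed
    moreover have "width p \<le> width u" using eq width_nonneg[of r] by simp
    then have "width p \<noteq> int (n * l)" using wuv width_nonneg[of v] unfolding width_append by linarith
    ultimately have "s + 1 \<le> level m n p" using strict[of p "r @ v @ z"] wuvz eq hp by simp
    then show ?thesis by simp
  qed
  then have "u \<in> first_passage m n s (height u)"
    using lu hu by (auto simp: first_passage_def)
  moreover have "level m n v = 0" using lu luv by simp
  moreover have "0 \<le> level m n p" if "v = p @ r" for p r
  proof -
    have "height (u @ p) \<noteq> 0" using hu height_nonneg[of p] by simp
    moreover have "width (u @ p) \<noteq> int (n * l)" using wuv that width_nonneg[of r] by simp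
    ultimately have "s \<le> level m n (u @ p)" using wp[of "u @ p" "r @ z"] wuvz that by simp
    then show ?thesis using lu by simp
  qed
  moreover have "z \<in> last_passage m n s (width z)"
  proof -
    have "0 < level m n p" if eq: "z = p @ r" and p: "p \<noteq> []" and wr: "width r \<noteq> 0" for p r
    proof -
      have "\<not> Q (length (u @ v @ p))"
      proof
        assume "Q (length (u @ v @ p))"
        then have "length (u @ v @ p) \<le> j" by (rule jmax)
        moreover have "length (u @ v) = j" using Qj by (simp add: Q_def flip: uv)
        ultimately show False using p by (cases p) auto
      qed
      moreover have "height (u @ v @ p) \<noteq> 0" using hu height_nonneg[of p] height_nonneg[of v] by simp
      moreover have "width (u @ v @ p) \<noteq> int (n * l)"
        using ww wr unfolding wuvz eq by simp
      ultimately have "s + 1 \<le> level m n (u @ v @ p)"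
        using strict[of "u @ v @ p" r] wuvz eq by simp
      then show ?thesis using luv by simp
    qed
    moreover have "1 \<le> width z" using wuv ww unfolding wuvz by simp
    moreover have "level m n w = 0" by (simp add: level_def ww hw)
    then have "level m n z = - s" using luv unfolding wuvz by simp
    ultimately show ?thesis by (auto simp: last_passage_def)
  qed
  ultimately show ?thesis using that wuvz by blast
qed

lemma touching_compose:
  assumes s: "0 < s" and u: "u \<in> first_passage m n s y" and v: "v \<in> paths m n 0 t"
    and z: "z \<in> last_passage m n s x"
    and ww: "width (u @ v @ z) = int (n * l)" and hw: "height (u @ v @ z) = int (m * l)"
  shows "u @ v @ z \<in> paths m n s l - paths m n (s + 1) l"
proof -
  have U: "level m n u = s" "1 \<le> height u"
    "\<And>p r. u = p @ r \<Longrightarrow> r \<noteq> [] \<Longrightarrow> height p \<noteq> 0 \<Longrightarrow> s < level m n p"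
    using u by (auto simp: first_passage_def)
  have V: "level m n v = 0" "\<And>p r. v = p @ r \<Longrightarrow> 0 \<le> level m n p"
    using v by (auto simp: paths_def level_def)
  have Z: "1 \<le> width z" "\<And>p r. z = p @ r \<Longrightarrow> p \<noteq> [] \<Longrightarrow> width r \<noteq> 0 \<Longrightarrow> 0 < level m n p"
    using z by (auto simp: last_passage_def)
  have main: "0 \<le> level m n p \<and> (width p \<noteq> int (n * l) \<and> height p \<noteq> 0 \<longrightarrow> s \<le> level m n p)"
    if "u @ v @ z = p @ r" for p r
    using that
  proof (cases rule: split_append_cases)
    case (left c)
    then show ?thesis using U(3)[of p c] level_nonneg_on_base[of p m n] s by fastforce
  next
    case (right c)
    note pc = this
    from pc(2) show ?thesis
    proof (cases rule: split_append_cases)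
      case (left e)
      then show ?thesis using pc U V(2)[of c e] s by simp
    next
      case (right e)
      show ?thesis
      proof (cases "width r = 0")
        case True
        have "width p = int (n * l)" "height p + height r = int (m * l)"
          using that True ww hw by simp_all
        then have "level m n p = int n * height r" by (simp add: level_def algebra_simps flip: distrib_left)
        then show ?thesis using \<open>width p = int (n * l)\<close> by (simp add: height_nonneg)
      next
        case False
        then have "0 \<le> level m n e" using Z(2)[of e r] right by (cases "e = []") auto
        then show ?thesis using pc right U V s by simp
      qed
    qed
  qed
  have "u @ v @ z \<notin> paths m n (s + 1) l"
  proof
    assume "u @ v @ z \<in> paths m n (s + 1) l"
    moreover have "width u \<noteq> int (n * l)" using ww Z(1) width_nonneg[of v]
      unfolding width_append by linarith
    ultimately have "s + 1 \<le> level m n u" using U(2) unfolding paths_def mem_Collect_eq by force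
    then show False using U by simp
  qed
  moreover have "u @ v @ z \<in> paths m n s l"
    unfolding paths_def mem_Collect_eq using main ww hw by blast
  ultimately show ?thesis by blast
qed

text \<open>A proper prefix of a first passage lies on the base line or above level \<open>s\<close>, so it is
  not itself a first passage to level \<open>s\<close>. This makes the cut points recoverable from the whole path.\<close>

lemma first_passage_prefix_unique:
  assumes s: "u \<in> first_passage m n s y" "u' \<in> first_passage m n s y'" "u @ v = u' @ v'"
  shows "u = u'"
proof -
  have no: False if "u \<in> first_passage m n s y" "u' \<in> first_passage m n s y'" "u = u' @ c" "c \<noteq> []" for u u' y y' c
    using that unfolding first_passage_def mem_Collect_eq by (metis less_irrefl not_one_le_zero)
  from s(3) show ?thesis
  proof (cases rule: split_append_cases)
    case (left c)
    then show ?thesis using no[OF s(1,2)] by blast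
  next
    case (right c)
    then show ?thesis using no[OF s(2,1)] by (cases "c = []") auto
  qed
qed

lemma last_passage_suffix_unique:
  assumes "z \<in> last_passage m n s x" "z' \<in> last_passage m n s x'" "v @ z = v' @ z'"
  shows "z = z'"
proof -
  have "reflect z = reflect z'"
  proof (rule first_passage_prefix_unique)
    show "reflect z \<in> first_passage n m s x" "reflect z' \<in> first_passage n m s x'"
      using assms by (auto simp: last_passage_reflect)
    show "reflect z @ reflect v = reflect z' @ reflect v'"
      using arg_cong[OF assms(3), of reflect] by simp
  qed
  then show ?thesis by (metis reflect_reflect)
qed

section \<open>First returns and paths far below the line\<close>

lemma paths_0_iff:
  "v \<in> paths m n 0 t \<longleftrightarrow> width v = int (n * t) \<and> height v = int (m * t) \<and>
     (\<forall>p r. v = p @ r \<longrightarrow> 0 \<le> level m n p)"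
  unfolding paths_def mem_Collect_eq by blast

text \<open>For \<open>s = 1\<close> the only points on the line are the two end points: on the base line and in the last
  column, where no midway condition applies, the level is positive anyway.\<close>

lemma paths_1_level_pos:
  assumes "m \<ge> 1" "n \<ge> 1" "u \<in> paths m n 1 k" "u = p @ r" "p \<noteq> []" "r \<noteq> []"
  shows "0 < level m n p"
proof (cases "height p = 0")
  case True
  then have "0 < width p" using width_height_pos[OF assms(5)] by simp
  then show ?thesis using True assms(1) by (simp add: level_def)
next
  case hp: False
  show ?thesis
  proof (cases "width p = int (n * k)")
    case True
    have tot: "width p + width r = int (n * k)" "height p + height r = int (m * k)"
      using assms(3,4) by (auto simp: paths_def)
    then have "0 < height r" using True width_height_pos[OF assms(6)] by simp
    moreover have "height p = int (m * k) - height r" using tot by simp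
    then have "level m n p = int n * height r"
      unfolding level_def True by (simp only:) (simp add: algebra_simps)
    ultimately show ?thesis using assms(2) by simp
  next
    case False
    then have "1 \<le> level m n p" using assms(3,4) hp unfolding paths_def mem_Collect_eq by blast
    then show ?thesis by simp
  qed
qed

lemma first_return_decompose:
  assumes m: "m \<ge> 1" and n: "n \<ge> 1" and co: "coprime m n"
    and w: "w \<in> paths m n 0 l" and l: "l \<ge> 1"
  obtains k u v where "w = u @ v" "1 \<le> k" "k \<le> l" "u \<in> paths m n 1 k" "v \<in> paths m n 0 (l - k)"
proof -
  have ww: "width w = int (n * l)" and hw: "height w = int (m * l)"
    and wp: "\<And>p r. w = p @ r \<Longrightarrow> 0 \<le> level m n p"
    using w by (auto simp: paths_0_iff)
  \<comment> \<open>\<open>Q i\<close>: the path is back on the line after \<open>i > 0\<close> steps.\<close>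
  define Q where "Q i \<longleftrightarrow> 0 < i \<and> i \<le> length w \<and> level m n (take i w) = 0" for i
  have "w \<noteq> []" using ww n l by auto
  then have "Q (length w)" using ww hw by (simp add: Q_def level_def)
  define i where "i = (LEAST i. Q i)"
  have Qi: "Q i" unfolding i_def using \<open>Q (length w)\<close> by (rule LeastI)
  have imin: "i \<le> k" if "Q k" for k unfolding i_def using that by (rule Least_le)
  define u where "u = take i w"
  define v where "v = drop i w"
  have wuv: "w = u @ v" by (simp add: u_def v_def)
  have lu: "level m n u = 0" "length u = i" "u \<noteq> []" using Qi by (auto simp: Q_def u_def)
  obtain k where k: "width u = int (n * k)" "height u = int (m * k)"
    using level_zero_multiple[OF m n co lu(1)] .
  have k1: "1 \<le> k" using width_height_pos[OF lu(3)] k by (cases k) auto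
  have "int n * int k \<le> int n * int l" using ww k width_nonneg[of v] unfolding wuv
    by (simp only: width_append of_nat_mult)
  then have kl: "k \<le> l" using n by simp
  have "u \<in> paths m n 1 k"
    unfolding paths_def mem_Collect_eq
  proof (intro conjI allI impI)
    fix p r assume eq: "u = p @ r"
    have *: "w = p @ (r @ v)" using wuv eq by simp
    then show "0 \<le> level m n p" by (rule wp)
    assume a: "width p \<noteq> int (n * k) \<and> height p \<noteq> 0"
    have "r \<noteq> []" using a eq k by auto
    have "level m n p \<noteq> 0"
    proof
      assume "level m n p = 0"
      then have "Q (length p)" using a * by (auto simp: Q_def)
      then show False using imin lu eq \<open>r \<noteq> []\<close> by fastforce
    qed
    then show "1 \<le> level m n p" using wp[OF *] by simp
  qed (use k in auto)
  moreover have "v \<in> paths m n 0 (l - k)"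
  proof -
    have "0 \<le> level m n p" if "v = p @ r" for p r
      using wp[of "u @ p" r] wuv that lu by simp
    moreover have "width v = int (n * (l - k))" "height v = int (m * (l - k))"
      using ww hw k kl unfolding wuv by (simp_all add: of_nat_diff algebra_simps)
    ultimately show ?thesis by (simp add: paths_0_iff)
  qed
  ultimately show ?thesis using that wuv k1 kl by blast
qed

lemma first_return_compose:
  assumes "u \<in> paths m n 1 k" "v \<in> paths m n 0 (l - k)" "k \<le> l"
  shows "u @ v \<in> paths m n 0 l"
proof -
  have U: "level m n u = 0" "width u = int (n * k)" "height u = int (m * k)"
    "\<And>p r. u = p @ r \<Longrightarrow> 0 \<le> level m n p"
    using assms(1) by (auto simp: paths_def level_def)
  have V: "width v = int (n * (l - k))" "height v = int (m * (l - k))" "\<And>p r. v = p @ r \<Longrightarrow> 0 \<le> level m n p"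
    using assms(2) by (auto simp: paths_0_iff)
  have "0 \<le> level m n p" if "u @ v = p @ r" for p r
    using that
  proof (cases rule: split_append_cases)
    case (left c)
    then show ?thesis using U(4) by blast
  next
    case (right c)
    then show ?thesis using U(1) V(3)[of c r] by simp
  qed
  then show ?thesis
    using U V assms(3) by (simp add: paths_0_iff of_nat_diff algebra_simps)
qed

lemma first_return_unique:
  assumes m: "m \<ge> 1" and n: "n \<ge> 1"
    and u: "u \<in> paths m n 1 k" and u': "u' \<in> paths m n 1 k'" and k: "1 \<le> k" "1 \<le> k'"
    and eq: "u @ v = u' @ v'"
  shows "u = u'"
proof -
  have no: False if "u \<in> paths m n 1 k" "u' \<in> paths m n 1 k'" "1 \<le> k'" "u = u' @ c" "c \<noteq> []"
    for u u' k k' c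
  proof -
    have "width u' = int (n * k')" "level m n u' = 0" using that by (auto simp: paths_def level_def)
    then have "u' \<noteq> []" using that n by auto
    then show False using paths_1_level_pos[OF m n that(1,4) _ that(5)] \<open>level m n u' = 0\<close> by simp
  qed
  from eq show ?thesis
  proof (cases rule: split_append_cases)
    case (left c)
    then show ?thesis using no[OF u u' k(2)] by blast
  next
    case (right c)
    then show ?thesis using no[OF u' u k(1)] by (cases "c = []") auto
  qed
qed

text \<open>The first point off the base line has height 1 and level at least \<open>m n\<close>, so its abscissa
  exceeds \<open>n\<close>. A point in the last column is no midway point, but then fewer than \<open>n\<close> right steps are
  possible only if \<open>l = 1\<close> and the path cuts the corner \<open>(n, 0)\<close>.\<close>

lemma paths_below_shifted_line_start:
  assumes m: "m \<ge> 1" and n: "n \<ge> 1" and l: "l \<ge> 1" and w: "w \<in> paths m n (int (m * n)) l"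
  obtains w' where "w = replicate n Right @ w'"
  | "l = 1" "w = replicate (n - 1) Right @ Diag # replicate (m - 1) Up"
proof -
  have ww: "width w = int (n * l)" and hw: "height w = int (m * l)"
    and wp: "\<And>p r. w = p @ r \<Longrightarrow> width p \<noteq> int (n * l) \<and> height p \<noteq> 0 \<Longrightarrow> int (m * n) \<le> level m n p"
    using w by (auto simp: paths_def)
  have nl: "n \<le> n * l" using l by simp
  obtain i r where ir: "w = replicate i Right @ r" "r = [] \<or> (\<exists>e r'. r = e # r' \<and> e \<noteq> Right)"
    using leading_steps[of w Right] by blast
  have "r \<noteq> []" using hw ir m l by auto
  then obtain e r' where r: "r = e # r'" "e \<noteq> Right" using ir by blast
  have ne: "north e = 1" using r by (cases e) auto
  have eq: "w = (replicate i Right @ [e]) @ r'" using ir r by simp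
  show ?thesis
  proof (cases "n \<le> i")
    case True
    then have "w = replicate n Right @ replicate (i - n) Right @ r"
      using ir by (simp flip: append_assoc replicate_add)
    then show ?thesis by (rule that(1))
  next
    case False
    have we: "width (replicate i Right @ [e]) = int (n * l)"
    proof (rule ccontr)
      assume "width (replicate i Right @ [e]) \<noteq> int (n * l)"
      then have "int (m * n) \<le> level m n (replicate i Right @ [e])"
        using wp[OF eq] ne by simp
      then have "int m * int n < int m * (int i + east e)"
        using ne n by (simp add: level_def algebra_simps)
      then have "int n < int i + east e" by (simp add: mult_less_cancel_left)
      moreover have "east e \<le> 1" by (cases e) auto
      ultimately show False using False by simp
    qed
    have e: "e = Diag"
    proof (cases e)
      case Up
      then have "int i = int (n * l)" using we by simp
      then show ?thesis using nl False by linarith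
    qed (use r in auto)
    then have i: "int i + 1 = int (n * l)" using we by simp
    then have "int (n * l) \<le> int n" using False by linarith
    then have l1: "l = 1" using l n by simp
    have i': "i = n - 1" using i l1 n by simp
    have wr: "width r' = 0" "height r' = int m - 1" using ww hw we unfolding eq
      by (simp_all add: l1 ne)
    obtain j q where q: "r' = replicate j Up @ q" "q = [] \<or> (\<exists>d q'. q = d # q' \<and> d \<noteq> Up)"
      using leading_steps[of r' Up] by blast
    have "q = []"
    proof (rule ccontr)
      assume "q \<noteq> []"
      then obtain d q' where "q = d # q'" "d \<noteq> Up" using q by blast
      then have "0 < width q" using width_nonneg[of q'] by (cases d) auto
      then show False using wr q by simp
    qed
    then have "int j = int m - 1" using wr q by simp
    then have "j = m - 1" using m by linarith
    then have "r' = replicate (m - 1) Up" using q \<open>q = []\<close> by simp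
    then show ?thesis using that(2)[OF l1] ir r e i' by simp
  qed
qed

text \<open>The final up steps come from \<open>paths_below_shifted_line_start\<close> applied to the reflected path.\<close>

lemma paths_below_shifted_line:
  assumes m: "m \<ge> 1" and n: "n \<ge> 1" and l: "l \<ge> 1"
  shows "paths m n (int (m * n)) l
    = (\<lambda>v. replicate n Right @ v @ replicate m Up) ` paths m n 0 (l - 1)
      \<union> (if l = 1 then {replicate (n - 1) Right @ Diag # replicate (m - 1) Up} else {})"
    (is "?L = ?f ` ?V \<union> ?S")
proof
  show "?L \<subseteq> ?f ` ?V \<union> ?S"
  proof
    fix w assume w: "w \<in> ?L"
    show "w \<in> ?f ` ?V \<union> ?S"
    proof (cases "w \<in> ?S")
      case False
      then have nS: "\<not> (l = 1 \<and> w = replicate (n - 1) Right @ Diag # replicate (m - 1) Up)" by auto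
      obtain w' where w': "w = replicate n Right @ w'"
        using paths_below_shifted_line_start[OF m n l w] nS by blast
      have "reflect w \<in> paths n m (int (n * m)) l"
        using w by (subst paths_reflect) (auto simp: mult.commute)
      moreover have "\<not> (l = 1 \<and> reflect w = replicate (m - 1) Right @ Diag # replicate (n - 1) Up)"
      proof
        assume *: "l = 1 \<and> reflect w = replicate (m - 1) Right @ Diag # replicate (n - 1) Up"
        then have "reflect (reflect w) = reflect (replicate (m - 1) Right @ Diag # replicate (n - 1) Up)"
          by simp
        then have "w = replicate (n - 1) Right @ Diag # replicate (m - 1) Up"
          by (simp add: reflect_Cons)
        then show False using nS * by blast
      qed
      ultimately obtain w'' where "reflect w = replicate m Right @ w''"
        using paths_below_shifted_line_start[OF n m l] by blast
      then have w'': "w = reflect w'' @ replicate m Up" by (simp add: reflect_split)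
      then have "replicate n Right @ w' = reflect w'' @ replicate m Up" using w' by simp
      then obtain v where v: "w = replicate n Right @ v @ replicate m Up"
      proof (cases rule: split_append_cases)
        case (left c)
        have "set c \<subseteq> {Right}" using arg_cong[OF left(1), of set] n by auto
        then have "Right \<in> set (c @ w')" using left(2) by (cases c) auto
        then show ?thesis using left(3) m by (metis in_set_replicate step.distinct(1))
      next
        case (right c)
        then show ?thesis using that w' by blast
      qed
      have "v \<in> ?V"
      proof -
        have ww: "width w = int (n * l)" and hw: "height w = int (m * l)"
          and wp: "\<And>p r. w = p @ r \<Longrightarrow> width p \<noteq> int (n * l) \<and> height p \<noteq> 0 \<Longrightarrow> int (m * n) \<le> level m n p"
          using w by (auto simp: paths_def)
        have wv: "width v = int (n * (l - 1))" "height v = int (m * (l - 1))"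
          using ww hw l unfolding v by (simp_all add: of_nat_diff algebra_simps)
        have "0 \<le> level m n p" if eq: "v = p @ r" for p r
        proof (cases "height p = 0")
          case True
          then show ?thesis by (rule level_nonneg_on_base)
        next
          case hp: False
          show ?thesis
          proof (cases "width (replicate n Right @ p) = int (n * l)")
            case True
            then have wpp: "width p = int n * int (l - 1)" using l by (simp add: of_nat_diff algebra_simps)
            have hpp: "height p = int m * int (l - 1) - height r" using wv eq by simp
            have "level m n p = int n * height r"
              unfolding level_def wpp hpp by (simp add: algebra_simps)
            then show ?thesis by (simp add: height_nonneg)
          next
            case False
            then have "int (m * n) \<le> level m n (replicate n Right @ p)"
              using wp[of "replicate n Right @ p" "r @ replicate m Up"] hp v eq by simp
            then show ?thesis by (simp add: level_def algebra_simps)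
          qed
        qed
        then show ?thesis using wv by (simp add: paths_0_iff)
      qed
      then show ?thesis using v by blast
    qed blast
  qed
  have "?f v \<in> ?L" if v: "v \<in> ?V" for v
  proof -
    have V: "width v = int (n * (l - 1))" "height v = int (m * (l - 1))"
      "\<And>p r. v = p @ r \<Longrightarrow> 0 \<le> level m n p" "level m n v = 0"
      using v by (auto simp: paths_0_iff level_def)
    have tot: "width (?f v) = int (n * l)" "height (?f v) = int (m * l)"
      using V l by (simp_all add: of_nat_diff algebra_simps)
    have "0 \<le> level m n p \<and> (width p \<noteq> int (n * l) \<and> height p \<noteq> 0 \<longrightarrow> int (m * n) \<le> level m n p)"
      if "?f v = p @ r" for p r
      using that
    proof (cases rule: split_append_cases)
      case (left c)
      have "height p + height c = 0" using arg_cong[OF left(1), of height] by simp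
      then have "height p = 0" using height_nonneg[of p] height_nonneg[of c] by linarith
      then show ?thesis using level_nonneg_on_base by simp
    next
      case (right c)
      note pc = this
      have lR: "level m n (replicate n Right) = int (m * n)" by (simp add: level_def)
      from pc(2) show ?thesis
      proof (cases rule: split_append_cases)
        case (left e)
        have "0 \<le> level m n c" using left V by blast
        then have "int (m * n) \<le> level m n p" using pc(1) lR by simp
        then show ?thesis using of_nat_0_le_iff[of "m * n"] by linarith
      next
        case (right e)
        have "width e + width r = 0" using arg_cong[OF right(2), of width] by simp
        then have "width r = 0" using width_nonneg[of e] width_nonneg[of r] by linarith
        then have wpp: "width p = int (n * l)" and hpp: "height p = int (m * l) - height r"
          using tot unfolding \<open>?f v = p @ r\<close> by simp_all
        have "level m n p = int n * height r"
          unfolding level_def wpp hpp by (simp add: algebra_simps)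
        then show ?thesis using wpp by (simp add: height_nonneg)
      qed
    qed
    then show ?thesis using tot unfolding paths_def mem_Collect_eq by blast
  qed
  moreover have "?S \<subseteq> ?L"
  proof (cases "l = 1")
    case l1: True
    let ?w = "replicate (n - 1) Right @ Diag # replicate (m - 1) Up"
    have tot: "width ?w = int (n * l)" "height ?w = int (m * l)"
      using m n l1 by (simp_all add: of_nat_diff)
    have "0 \<le> level m n p \<and> (width p \<noteq> int (n * l) \<and> height p \<noteq> 0 \<longrightarrow> int (m * n) \<le> level m n p)"
      if "?w = p @ r" for p r
      using that
    proof (cases rule: split_append_cases)
      case (left c)
      have "height p + height c = 0" using arg_cong[OF left(1), of height] by simp
      then have "height p = 0" using height_nonneg[of p] height_nonneg[of c] by linarith
      then show ?thesis using level_nonneg_on_base by simp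
    next
      case (right c)
      show ?thesis
      proof (cases c)
        case Nil
        then have "height p = 0" using right by simp
        then show ?thesis using level_nonneg_on_base by simp
      next
        case (Cons d e)
        then have e: "replicate (m - 1) Up = e @ r" using right by simp
        have "width e + width r = 0" using arg_cong[OF e, of width] by simp
        then have "width r = 0" using width_nonneg[of e] width_nonneg[of r] by linarith
        then have wpp: "width p = int (n * l)" and hpp: "height p = int (m * l) - height r"
          using tot unfolding \<open>?w = p @ r\<close> by simp_all
        have "level m n p = int n * height r"
          unfolding level_def wpp hpp by (simp add: algebra_simps)
        then show ?thesis using wpp by (simp add: height_nonneg)
      qed
    qed
    then have "?w \<in> ?L" using tot unfolding paths_def mem_Collect_eq by blast
    then show ?thesis by (auto simp del: One_nat_def split: if_splits)
  qed simp
  ultimately show "?f ` ?V \<union> ?S \<subseteq> ?L" by blast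
qed

section \<open>Weighted sums\<close>

lemma qpow_0 [simp]: "qpow 0 = 1"
  by (simp add: qpow_def flip: zero_prod_def)

lemma qpow_add: "qpow (i + j) = qpow i * qpow j"
  by (simp add: qpow_def mult_single)

lemma qpow_power: "qpow k ^ l = qpow (int l * k)"
  by (induction l) (simp_all add: qpow_add algebra_simps)

lemma wt_append:
  "wt (u @ v) = qpow (width u * height v - height u * width v) * wt u * wt v"
proof -
  have "sweep (u @ v) = (width u * height v - height u * width v) + (sweep u + sweep v)" by simp
  then show ?thesis
    unfolding wt_def by (simp only: qpow_add) (simp add: power_add algebra_simps)
qed

lemma wt_replicate [simp]: "d \<noteq> Diag \<Longrightarrow> wt (replicate k d) = 1"
  by (simp add: wt_def)

text \<open>The coefficient of \<open>x\<^sup>l\<close> in \<open>y\<^sup>[\<^sup>s\<^sup>]\<close>, see \<open>nth_schroeder_gf\<close>. The case distinction is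
  the convention that no path is counted for \<open>s > m n l\<close>.\<close>

definition path_sum :: "nat \<Rightarrow> nat \<Rightarrow> nat \<Rightarrow> nat \<Rightarrow> laurent" where
  "path_sum m n s l = (if s > m * n * l then 0 else sum wt (paths m n (int s) l))"

lemma path_sum_reflect: "path_sum n m s l = path_sum m n s l"
  unfolding path_sum_def by (subst paths_reflect) (simp add: sum.reindex inj_reflect mult.commute)

lemma sum_last_passage: "sum wt (last_passage m n s x) = sum wt (first_passage n m s x)"
  by (simp add: last_passage_reflect sum.reindex inj_reflect)

lemma sum_first_passage_Right_shift:
  assumes "n \<ge> 1" "0 \<le> s"
  shows "sum wt (first_passage m n (s + int m * int K) y)
    = qpow (int K * y) * sum wt (first_passage m n s y)"
proof -
  have "sum wt (first_passage m n (s + int m * int K) y)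
    = (\<Sum>u\<in>first_passage m n s y. wt (replicate K Right @ u))"
    by (simp add: first_passage_Right_shift[OF assms] sum.reindex inj_on_def)
  also have "\<dots> = (\<Sum>u\<in>first_passage m n s y. qpow (int K * y) * wt u)"
    by (rule sum.cong) (auto simp: wt_append first_passage_def)
  finally show ?thesis by (simp add: sum_distrib_left)
qed

text \<open>The shift by \<open>K\<close> right steps, read in the opposite direction if \<open>K\<close> is negative; this is possible on the
  level of weighted sums because \<open>q\<close> is invertible.\<close>

lemma sum_first_passage_change_level:
  assumes n: "n \<ge> 1" and s: "0 \<le> s" "0 \<le> s'" and K: "s' = s + int m * K"
  shows "sum wt (first_passage m n s y) = qpow (- (K * y)) * sum wt (first_passage m n s' y)"
proof (cases "0 \<le> K")
  case True
  then obtain k where k: "K = int k" using nonneg_int_cases by blast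
  show ?thesis
    unfolding K k sum_first_passage_Right_shift[OF n s(1)]
    by (simp flip: mult.assoc qpow_add)
next
  case False
  then obtain k where k: "K = - int k" by (metis nle_le nonpos_int_cases)
  have "s = s' + int m * int k" using K k by simp
  then show ?thesis using sum_first_passage_Right_shift[OF n s(2), of m k y] k by simp
qed

lemma path_sum_first_passage:
  assumes m: "m \<ge> 1" and n: "n \<ge> 1" and b: "b < m"
  shows "path_sum m n (b * n + 1) l
    = qpow (int (b * n * l)) * sum wt (first_passage m n (int (b * n)) (int (m * l) - int b))"
proof (cases "l = 0")
  case True
  then have "first_passage m n (int (b * n)) (int (m * l) - int b) = {}"
    by (auto simp: first_passage_def)
  then show ?thesis using True by (simp add: path_sum_def)
next
  case False
  then have l: "l \<ge> 1" by simp
  have "b * n < m * n" using b n by simp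
  also have "m * n \<le> m * n * l" using l by simp
  finally have "\<not> b * n + 1 > m * n * l" by linarith
  then have "path_sum m n (b * n + 1) l = sum wt (paths m n (int (b * n) + 1) l)"
    by (simp add: path_sum_def add.commute)
  also have "\<dots> = (\<Sum>u\<in>first_passage m n (int (b * n)) (int (m * l) - int b). wt (u @ replicate b Up))"
    unfolding paths_eq_first_passage_Ups[OF m l b n] by (simp add: sum.reindex inj_on_def)
  also have "\<dots> = (\<Sum>u\<in>first_passage m n (int (b * n)) (int (m * l) - int b). qpow (int (b * n * l)) * wt u)"
  proof (rule sum.cong[OF refl])
    fix u assume "u \<in> first_passage m n (int (b * n)) (int (m * l) - int b)"
    then have hu: "height u = int m * int l - int b" and "int m * width u = int b * int n + int n * height u"
      by (auto simp: first_passage_def level_def)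
    then have "int m * width u = int m * int (n * l)"
      unfolding hu by (simp add: algebra_simps)
    then have "width u = int (n * l)" using m by simp
    then show "wt (u @ replicate b Up) = qpow (int (b * n * l)) * wt u"
      by (simp add: wt_append algebra_simps)
  qed
  finally show ?thesis by (simp add: sum_distrib_left)
qed

text \<open>The contribution of the part before the first contact, expressed by \<open>y\<^sup>[\<^sup>b\<^sup>n\<^sup>+\<^sup>1\<^sup>]\<close>. For \<open>l = 0\<close>
  both sides vanish.\<close>

lemma sum_first_passage:
  assumes m: "m \<ge> 1" and n: "n \<ge> 1" and b: "b < m" and s: "0 \<le> s" and K: "int (b * n) = s + int m * K"
  shows "sum wt (first_passage m n s (int (m * l) - int b))
    = qpow (- (K * (int (m * l) - int b)) - int (b * n * l)) * path_sum m n (b * n + 1) l"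
proof -
  have "qpow (- int (b * n * l)) * path_sum m n (b * n + 1) l
     = sum wt (first_passage m n (int (b * n)) (int (m * l) - int b))"
    unfolding path_sum_first_passage[OF m n b]
    by (simp flip: mult.assoc qpow_add)
  then have "sum wt (first_passage m n s (int (m * l) - int b))
    = qpow (- (K * (int (m * l) - int b))) * (qpow (- int (b * n * l)) * path_sum m n (b * n + 1) l)"
    using sum_first_passage_change_level[OF n s _ K] by simp
  then show ?thesis by (simp only: qpow_add diff_conv_add_uminus mult.assoc)
qed

lemma path_sum_first_return:
  assumes m: "m \<ge> 1" and n: "n \<ge> 1" and co: "coprime m n" and l: "l \<ge> 1"
  shows "path_sum m n 0 l = (\<Sum>k=1..l. path_sum m n 1 k * path_sum m n 0 (l - k))"
proof -
  let ?I = "Sigma {1..l} (\<lambda>k. paths m n 1 k \<times> paths m n 0 (l - k))"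
  have bij: "bij_betw (\<lambda>(k, u, v). u @ v) ?I (paths m n 0 l)"
    unfolding bij_betw_def
  proof
    show "inj_on (\<lambda>(k, u, v). u @ v) ?I"
    proof (rule inj_onI, clarsimp)
      fix k u v k' u' v'
      assume a: "u \<in> paths m n 1 k" "u' \<in> paths m n 1 k'" "Suc 0 \<le> k" "Suc 0 \<le> k'" "u @ v = u' @ v'"
      then have "u = u'" using first_return_unique[OF m n] by simp
      moreover have "int n * int k = int n * int k'" using a(1,2) \<open>u = u'\<close> by (simp add: paths_def)
      then have "k = k'" using n by simp
      ultimately show "k = k' \<and> u = u' \<and> v = v'" using a by simp
    qed
    show "(\<lambda>(k, u, v). u @ v) ` ?I = paths m n 0 l"
    proof
      show "(\<lambda>(k, u, v). u @ v) ` ?I \<subseteq> paths m n 0 l"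
        using first_return_compose by auto
      show "paths m n 0 l \<subseteq> (\<lambda>(k, u, v). u @ v) ` ?I"
      proof
        fix w assume "w \<in> paths m n 0 l"
        from first_return_decompose[OF m n co this l] obtain k u v where
          "w = u @ v" "1 \<le> k" "k \<le> l" "u \<in> paths m n 1 k" "v \<in> paths m n 0 (l - k)" .
        then show "w \<in> (\<lambda>(k, u, v). u @ v) ` ?I"
          by (intro image_eqI[of _ _ "(k, u, v)"]) auto
      qed
    qed
  qed
  have "path_sum m n 0 l = sum wt (paths m n 0 l)" by (simp add: path_sum_def)
  also have "\<dots> = (\<Sum>(k, u, v)\<in>?I. wt (u @ v))"
    using sum.reindex_bij_betw[OF bij, of wt] by (simp add: case_prod_unfold)
  also have "\<dots> = (\<Sum>(k, u, v)\<in>?I. wt u * wt v)"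
  proof (rule sum.cong[OF refl], clarsimp)
    fix k u v assume "u \<in> paths m n 1 k" "v \<in> paths m n 0 (l - k)"
    then have "width u = int n * int k" "height u = int m * int k"
      "width v = int n * int (l - k)" "height v = int m * int (l - k)"
      by (simp_all add: paths_def)
    then have "width u * height v - height u * width v = 0" by simp
    then show "wt (u @ v) = wt u * wt v" by (simp only: wt_append qpow_0 mult_1_left)
  qed
  also have "\<dots> = (\<Sum>k=1..l. \<Sum>(u, v)\<in>paths m n 1 k \<times> paths m n 0 (l - k). wt u * wt v)"
    by (subst sum.Sigma) (auto simp: finite_paths case_prod_unfold)
  also have "\<dots> = (\<Sum>k=1..l. path_sum m n 1 k * path_sum m n 0 (l - k))"
  proof (rule sum.cong[OF refl])
    fix k assume "k \<in> {1..l}"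
    then have "1 \<le> m * n * k" using m n by simp
    then show "(\<Sum>(u, v)\<in>paths m n 1 k \<times> paths m n 0 (l - k). wt u * wt v)
      = path_sum m n 1 k * path_sum m n 0 (l - k)"
      by (simp add: path_sum_def sum_product sum.cartesian_product)
  qed
  finally show ?thesis .
qed

lemma path_sum_shifted_line:
  assumes m: "m \<ge> 1" and n: "n \<ge> 1" and l: "l \<ge> 1"
  shows "path_sum m n (m * n) l = qpow (int (m * n)) * (qpow (2 * int (m * n)) ^ (l - 1) * path_sum m n 0 (l - 1))
    + (if l = 1 then avar\<^sup>2 * qpow (int (m * n) - 1) else 0)"
proof -
  let ?f = "\<lambda>v. replicate n Right @ v @ replicate m Up"
  let ?d = "replicate (n - 1) Right @ Diag # replicate (m - 1) Up"
  \<comment> \<open>The two kinds of paths differ in their \<open>n\<close>-th step.\<close>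
  have notin: "?d \<notin> ?f ` A" for A
  proof
    assume "?d \<in> ?f ` A"
    then obtain v where "?d = ?f v" by blast
    also have "\<dots> = replicate (n - 1) Right @ Right # v @ replicate m Up"
      using n by (cases n) (simp_all add: replicate_append_same flip: replicate_Suc)
    finally show False by simp
  qed
  have d: "wt ?d = avar\<^sup>2 * qpow (int (m * n) - 1)"
  proof -
    have "sweep ?d = int (m * n) - 1" using m n by (simp add: of_nat_diff algebra_simps)
    moreover have "count_list ?d Diag = 1" by simp
    ultimately show ?thesis by (simp add: wt_def)
  qed
  have "sum wt (?f ` paths m n 0 (l - 1)) = (\<Sum>v\<in>paths m n 0 (l - 1). wt (?f v))"
    by (simp add: sum.reindex inj_on_def)
  also have "\<dots> = (\<Sum>v\<in>paths m n 0 (l - 1). qpow (int (m * n)) * (qpow (2 * int (m * n)) ^ (l - 1) * wt v))"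
  proof (rule sum.cong[OF refl])
    fix v assume "v \<in> paths m n 0 (l - 1)"
    then have "width v = int n * int (l - 1)" "height v = int m * int (l - 1)" by (simp_all add: paths_def)
    then have "sweep (?f v) = int (m * n) + (int (l - 1) * (2 * int (m * n)) + sweep v)"
      by (simp add: algebra_simps)
    moreover have "count_list (?f v) Diag = count_list v Diag" by simp
    ultimately show "wt (?f v) = qpow (int (m * n)) * (qpow (2 * int (m * n)) ^ (l - 1) * wt v)"
      unfolding wt_def qpow_power by (simp only: qpow_add) (simp add: algebra_simps)
  qed
  also have "\<dots> = qpow (int (m * n)) * (qpow (2 * int (m * n)) ^ (l - 1) * path_sum m n 0 (l - 1))"
    by (simp add: path_sum_def sum_distrib_left)
  finally have main: "sum wt (?f ` paths m n 0 (l - 1)) = \<dots>" .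
  have "path_sum m n (m * n) l = sum wt (paths m n (int (m * n)) l)"
    using l by (simp add: path_sum_def)
  also have "\<dots> = sum wt (?f ` paths m n 0 (l - 1)) + sum wt (if l = 1 then {?d} else {})"
    unfolding paths_below_shifted_line[OF m n l]
    by (rule sum.union_disjoint) (use notin in \<open>auto simp: finite_paths\<close>)
  finally show ?thesis unfolding main using d by auto
qed

lemma sum_triple_product:
  fixes c :: "'a :: comm_semiring_0"
  shows "(\<Sum>(u, v, z)\<in>A \<times> B \<times> C. c * (f u * g v * h z)) = c * (sum f A * sum g B * sum h C)"
proof -
  have BC: "sum g B * sum h C = (\<Sum>p\<in>B \<times> C. g (fst p) * h (snd p))"
    by (simp add: sum_product sum.cartesian_product case_prod_unfold)
  have "sum f A * (sum g B * sum h C) = (\<Sum>x\<in>A \<times> B \<times> C. f (fst x) * (g (fst (snd x)) * h (snd (snd x))))"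
    unfolding BC by (simp add: sum_product sum.cartesian_product case_prod_unfold)
  then show ?thesis unfolding case_prod_unfold sum_distrib_left[symmetric] mult.assoc by simp
qed

lemma paths_size_0: "paths m n s 0 = {[]}"
proof
  show "paths m n s 0 \<subseteq> {[]}"
  proof
    fix w assume "w \<in> paths m n s 0"
    then show "w \<in> {[]}" using width_height_pos[of w] by (auto simp: paths_def)
  qed
qed (auto simp: paths_def)

text \<open>The coefficient form of the equation for \<open>0 < s < m n\<close>. A path with a contact at level \<open>s\<close> corresponds
  to indices \<open>i - j\<close>, \<open>j\<close> and \<open>l + \<epsilon> - i\<close>, the sizes of the paths obtained from its first,
  middle and last part, together with these parts.\<close>

lemma path_sum_touching:
  assumes m: "m \<ge> 1" and n: "n \<ge> 1" and co: "coprime m n" and s: "0 < s" "s < m * n"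
    and a: "a < n" and b: "b < m"
    and e: "int s = int a * int m + int b * int n - int (m * n) * int \<epsilon>"
  shows "path_sum m n s l = path_sum m n (s + 1) l
    + qpow (int (m * n) * (int \<epsilon>)\<^sup>2 - 2 * int a * int b) *
      (\<Sum>i=0..l + \<epsilon>. (\<Sum>j=0..i. qpow (2 * int s) ^ j * path_sum m n 0 j
           * (qpow (2 * (int s - int (b * n))) ^ (i - j) * path_sum m n (b * n + 1) (i - j)))
         * (qpow (2 * (int s - int (a * m))) ^ (l + \<epsilon> - i) * path_sum m n (a * m + 1) (l + \<epsilon> - i)))"
proof -
  let ?L = "l + \<epsilon>"
  \<comment> \<open>\<open>K\<close> and \<open>K'\<close> are the numbers of steps, possibly negative, by which the two outer parts are lengthened.\<close>
  define K where "K = int n * int \<epsilon> - int a"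
  define K' where "K' = int m * int \<epsilon> - int b"
  have K: "int (b * n) = int s + int m * K" and K': "int (a * m) = int s + int n * K'"
    unfolding K_def K'_def e by (simp_all add: algebra_simps)
  let ?A = "\<lambda>i. first_passage m n (int s) (int (m * i) - int b)"
  let ?Z = "\<lambda>i. last_passage m n (int s) (int (n * i) - int a)"
  let ?J = "Sigma {0..?L} (\<lambda>i. {0..i})"
  let ?I = "Sigma ?J (\<lambda>(i, j). ?A (i - j) \<times> paths m n 0 j \<times> ?Z (?L - i))"
  let ?T = "paths m n (int s) l - paths m n (int s + 1) l"
  have dim_u: "width u = int n * int k - K" "height u = int m * int k - int b" if "u \<in> ?A k" for u k
  proof -
    show hu: "height u = int m * int k - int b" using that by (simp add: first_passage_def)
    have "int m * width u = int s + int n * height u"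
      using that by (auto simp: first_passage_def level_def)
    also have "\<dots> = int m * (int n * int k - K)"
      using K unfolding hu by (simp add: algebra_simps)
    finally show "width u = int n * int k - K" using m by simp
  qed
  have dim_z: "height z = int m * int k - K'" "width z = int n * int k - int a" if "z \<in> ?Z k" for z k
  proof -
    show wz: "width z = int n * int k - int a" using that by (simp add: last_passage_def)
    have "int n * height z = int s + int m * width z"
      using that by (auto simp: last_passage_def level_def)
    also have "\<dots> = int n * (int m * int k - K')"
      using K' unfolding wz by (simp add: algebra_simps)
    finally show "height z = int m * int k - K'" using n by simp
  qed
  have dim_v: "width v = int n * int j" "height v = int m * int j" if "v \<in> paths m n 0 j" for v j
    using that by (simp_all add: paths_def)
  have bij: "bij_betw (\<lambda>(_, u, v, z). u @ v @ z) ?I ?T"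
    unfolding bij_betw_def
  proof
    show "inj_on (\<lambda>(_, u, v, z). u @ v @ z) ?I"
    proof (rule inj_onI)
      fix x x' assume x: "x \<in> ?I" and x': "x' \<in> ?I"
        and xx: "(\<lambda>(_, u, v, z). u @ v @ z) x = (\<lambda>(_, u, v, z). u @ v @ z) x'"
      obtain i j u v z where xe: "x = ((i, j), u, v, z)" by (metis surj_pair)
      obtain i' j' u' v' z' where xe': "x' = ((i', j'), u', v', z')" by (metis surj_pair)
      have A: "u \<in> ?A (i - j)" "u' \<in> ?A (i' - j')"
        and V: "v \<in> paths m n 0 j" "v' \<in> paths m n 0 j'"
        and Z: "z \<in> ?Z (?L - i)" "z' \<in> ?Z (?L - i')"
        and eq: "u @ v @ z = u' @ v' @ z'" and le: "j \<le> i" "j' \<le> i'"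
        using x x' xx unfolding xe xe' by auto
      have u: "u = u'" by (rule first_passage_prefix_unique[OF A eq])
      have z: "z = z'"
        using last_passage_suffix_unique[OF Z, of "u @ v" "u' @ v'"] eq by simp
      have v: "v = v'" using eq u z by simp
      have "int m * int (i - j) = int m * int (i' - j')" using A u by (simp add: first_passage_def)
      then have "i - j = i' - j'" using m by simp
      moreover have "int n * int j = int n * int j'" using V v by (simp add: paths_def)
      then have "j = j'" using n by simp
      ultimately show "x = x'" using u v z le unfolding xe xe' by simp
    qed
    show "(\<lambda>(_, u, v, z). u @ v @ z) ` ?I = ?T"
    proof
      show "(\<lambda>(_, u, v, z). u @ v @ z) ` ?I \<subseteq> ?T"
      proof clarify
        fix i j u v z
        assume ij: "i \<in> {0..?L}" "j \<in> {0..i}" and u: "u \<in> ?A (i - j)" and v: "v \<in> paths m n 0 j"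
          and z: "z \<in> ?Z (?L - i)"
        show "u @ v @ z \<in> ?T"
        proof (rule touching_compose[OF _ u v z])
          show "0 < int s" using s by simp
          show "width (u @ v @ z) = int (n * l)"
            using ij dim_u[OF u] dim_v[OF v] dim_z[OF z]
            by (simp add: K_def of_nat_diff algebra_simps)
          show "height (u @ v @ z) = int (m * l)"
            using ij dim_u[OF u] dim_v[OF v] dim_z[OF z]
            by (simp add: K'_def of_nat_diff algebra_simps)
        qed
      qed
      show "?T \<subseteq> (\<lambda>(_, u, v, z). u @ v @ z) ` ?I"
      proof
        fix w assume w: "w \<in> ?T"
        obtain u v z where uvz: "w = u @ v @ z" "u \<in> first_passage m n (int s) (height u)"
          "level m n v = 0" "\<And>p r. v = p @ r \<Longrightarrow> 0 \<le> level m n p"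
          "z \<in> last_passage m n (int s) (width z)"
          using touching_decompose[of "int s" w m n l] w s by auto
        obtain t where t: "width v = int (n * t)" "height v = int (m * t)"
          using level_zero_multiple[OF m n co uvz(3)] .
        have v: "v \<in> paths m n 0 t" using t uvz(4) by (simp add: paths_0_iff)
        have "int m * (width u + K) = int n * (height u + int b)"
          using uvz(2) K by (simp add: first_passage_def level_def algebra_simps)
        then have "int m dvd int n * (height u + int b)" by (metis dvd_triv_left)
        then have "int m dvd height u + int b"
          using co by (simp add: coprime_dvd_mult_right_iff)
        moreover have "0 \<le> height u + int b" using height_nonneg[of u] by simp
        ultimately obtain k where k: "height u + int b = int (m * k)"
          by (metis dvdE int_dvd_int_iff nonneg_int_cases)
        have "int n * (height z + K') = int m * (width z + int a)"
          using uvz(5) K' by (simp add: last_passage_def level_def algebra_simps)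
        then have "int n dvd int m * (width z + int a)" by (metis dvd_triv_left)
        then have "int n dvd width z + int a"
          using co by (simp add: coprime_dvd_mult_right_iff coprime_commute)
        moreover have "0 \<le> width z + int a" using width_nonneg[of z] by simp
        ultimately obtain k' where k': "width z + int a = int (n * k')"
          by (metis dvdE int_dvd_int_iff nonneg_int_cases)
        have hu: "height u = int (m * k) - int b" using k by simp
        have wz: "width z = int (n * k') - int a" using k' by simp
        have u: "u \<in> ?A k" using uvz(2) by (simp only: flip: hu)
        have z: "z \<in> ?Z k'" using uvz(5) by (simp only: flip: wz)
        have "int (n * l) = width w" using w by (simp add: paths_def)
        also have "\<dots> = int n * (int k + int t + int k' - int \<epsilon>)"
          using dim_u[OF u] dim_z[OF z] t unfolding uvz(1) by (simp add: K_def algebra_simps)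
        finally have "int l = int k + int t + int k' - int \<epsilon>" using n by simp
        then have L: "?L = k + t + k'" by linarith
        show "w \<in> (\<lambda>(_, u, v, z). u @ v @ z) ` ?I"
          by (rule image_eqI[of _ _ "((k + t, t), u, v, z)"]) (use uvz(1) u v z L in auto)
      qed
    qed
  qed
  have sumA: "sum wt (?A k) = qpow (- (K * (int (m * k) - int b)) - int (b * n * k)) * path_sum m n (b * n + 1) k" for k
    by (rule sum_first_passage[OF m n b _ K]) simp
  have sumZ: "sum wt (?Z k) = qpow (- (K' * (int (n * k) - int a)) - int (a * m * k)) * path_sum m n (a * m + 1) k" for k
    unfolding sum_last_passage path_sum_reflect[of n m "a * m + 1" k, symmetric]
    by (rule sum_first_passage[OF n m a _ K']) simp
  \<comment> \<open>Sum of the cross products of the displacements of the three parts.\<close>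
  define X where "X k t k' = (int n * int k - K) * (int m * int t) - (int m * int k - int b) * (int n * int t)
      + ((int n * int k - K) * (int m * int k' - K') - (int m * int k - int b) * (int n * int k' - int a))
      + (int n * int t * (int m * int k' - K') - int m * int t * (int n * int k' - int a))" for k t k'
  have wtX: "wt (u @ v @ z) = qpow (X k t k') * (wt u * wt v * wt z)"
    if "u \<in> ?A k" "v \<in> paths m n 0 t" "z \<in> ?Z k'" for u v z k t k'
  proof -
    have "sweep (u @ v @ z) = X k t k' + (sweep u + (sweep v + sweep z))"
      unfolding sweep_append width_append height_append X_def
        dim_u[OF that(1)] dim_v[OF that(2)] dim_z[OF that(3)]
      by (simp add: algebra_simps)
    then show ?thesis
      unfolding wt_def by (simp only: qpow_add) (simp add: power_add algebra_simps)
  qed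
  have fin: "finite (first_passage m n r y)" "finite (last_passage m n r y)" for r y
    using finite_first_passage[OF m] finite_first_passage[OF n] by (auto simp: last_passage_reflect)
  define c where "c = int (m * n) * (int \<epsilon>)\<^sup>2 - 2 * int a * int b"
  have "sum wt ?T = (\<Sum>x\<in>?I. wt ((\<lambda>(_, u, v, z). u @ v @ z) x))"
    using sum.reindex_bij_betw[OF bij, of wt] by simp
  also have "\<dots> = (\<Sum>((i, j), u, v, z)\<in>?I. qpow (X (i - j) j (?L - i)) * (wt u * wt v * wt z))"
    by (rule sum.cong[OF refl]) (use wtX in \<open>clarsimp simp del: append_assoc\<close>)
  also have "\<dots> = (\<Sum>(i, j)\<in>?J. \<Sum>(u, v, z)\<in>?A (i - j) \<times> paths m n 0 j \<times> ?Z (?L - i).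
      qpow (X (i - j) j (?L - i)) * (wt u * wt v * wt z))"
    unfolding case_prod_unfold by (subst sum.Sigma) (auto simp: fin finite_paths case_prod_unfold)
  also have "\<dots> = (\<Sum>(i, j)\<in>?J. qpow (X (i - j) j (?L - i)) *
      (sum wt (?A (i - j)) * path_sum m n 0 j * sum wt (?Z (?L - i))))"
    unfolding sum_triple_product by (simp add: path_sum_def)
  also have "\<dots> = (\<Sum>(i, j)\<in>?J. qpow c * (qpow (2 * int s) ^ j * path_sum m n 0 j
           * (qpow (2 * (int s - int (b * n))) ^ (i - j) * path_sum m n (b * n + 1) (i - j))
         * (qpow (2 * (int s - int (a * m))) ^ (?L - i) * path_sum m n (a * m + 1) (?L - i))))"
  proof (rule sum.cong[OF refl], clarify)
    fix i j
    let ?k = "i - j" and ?k' = "?L - i"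
    \<comment> \<open>Collecting all exponents of \<open>q\<close>; after elimination of \<open>s\<close> this is an identity of polynomials.\<close>
    have "X ?k j ?k' + (- (K * (int (m * ?k) - int b)) - int (b * n * ?k))
        + (- (K' * (int (n * ?k') - int a)) - int (a * m * ?k'))
      = c + int j * (2 * int s) + int ?k * (2 * (int s - int (b * n))) + int ?k' * (2 * (int s - int (a * m)))"
      unfolding X_def c_def K_def K'_def e of_nat_mult by algebra
    then have *: "qpow (X ?k j ?k') * qpow (- (K * (int (m * ?k) - int b)) - int (b * n * ?k))
        * qpow (- (K' * (int (n * ?k') - int a)) - int (a * m * ?k'))
      = qpow c * qpow (2 * int s) ^ j * qpow (2 * (int s - int (b * n))) ^ ?k
         * qpow (2 * (int s - int (a * m))) ^ ?k'"
      unfolding qpow_power qpow_add[symmetric] by (rule arg_cong)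
    have "qpow (X ?k j ?k') * (sum wt (?A ?k) * path_sum m n 0 j * sum wt (?Z ?k'))
      = (qpow (X ?k j ?k') * qpow (- (K * (int (m * ?k) - int b)) - int (b * n * ?k))
        * qpow (- (K' * (int (n * ?k') - int a)) - int (a * m * ?k')))
        * (path_sum m n 0 j * path_sum m n (b * n + 1) ?k * path_sum m n (a * m + 1) ?k')"
      unfolding sumA sumZ by (simp only: mult.assoc mult.commute mult.left_commute)
    also have "\<dots> = qpow c * (qpow (2 * int s) ^ j * path_sum m n 0 j
           * (qpow (2 * (int s - int (b * n))) ^ ?k * path_sum m n (b * n + 1) ?k)
         * (qpow (2 * (int s - int (a * m))) ^ ?k' * path_sum m n (a * m + 1) ?k'))"
      unfolding * by (simp only: mult.assoc mult.commute mult.left_commute)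
    finally show "qpow (X ?k j ?k') * (sum wt (?A ?k) * path_sum m n 0 j * sum wt (?Z ?k')) = \<dots>" .
  qed
  also have "\<dots> = qpow c *
      (\<Sum>i=0..?L. (\<Sum>j=0..i. qpow (2 * int s) ^ j * path_sum m n 0 j
           * (qpow (2 * (int s - int (b * n))) ^ (i - j) * path_sum m n (b * n + 1) (i - j)))
         * (qpow (2 * (int s - int (a * m))) ^ (?L - i) * path_sum m n (a * m + 1) (?L - i)))"
    unfolding sum_distrib_right sum_distrib_left by (subst sum.Sigma) (auto simp: case_prod_unfold)
  finally have T: "sum wt ?T = \<dots>" .
  have "path_sum m n s l = path_sum m n (s + 1) l + sum wt ?T"
  proof (cases "l = 0")
    case True
    then show ?thesis using s by (simp add: path_sum_def paths_size_0)
  next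
    case False
    then have "s + 1 \<le> m * n * l" using s by (simp add: Suc_leI order_less_le_trans)
    then have "path_sum m n s l = sum wt (paths m n (int s) l)"
      "path_sum m n (s + 1) l = sum wt (paths m n (int s + 1) l)"
      by (auto simp: path_sum_def add.commute)
    moreover have "paths m n (int s + 1) l \<subseteq> paths m n (int s) l"
      by (fastforce simp: paths_def)
    ultimately show ?thesis
      using sum.subset_diff[of "paths m n (int s + 1) l" "paths m n (int s) l" wt] finite_paths
      by (simp add: add.commute)
  qed
  then show ?thesis unfolding T c_def .
qed

section \<open>The area between a path and the line\<close>

text \<open>This is \<open>region_below_line\<close> for an arbitrary set of points in place of a trace, so that it can be
  split into the contributions of single steps.\<close>

definition below_line :: "nat \<Rightarrow> nat \<Rightarrow> (real \<times> real) set \<Rightarrow> (real \<times> real) set" where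
  "below_line m n T = {(x, y). \<exists>y'. (x, y') \<in> T \<and> y' \<le> y \<and> y \<le> real m * x / real n}"

lemma below_line_Un: "below_line m n (S \<union> T) = below_line m n S \<union> below_line m n T"
  by (auto simp: below_line_def)

text \<open>By Fubini: the slice at \<open>x\<close> is an interval whose length is affine in \<open>x\<close>.\<close>

lemma measure_between_lines:
  fixes a b c d e h :: real
  assumes "a \<le> b" and le: "\<And>x. a \<le> x \<Longrightarrow> x \<le> b \<Longrightarrow> c * x + d \<le> e * x + h"
  defines "R \<equiv> {(x, y). a \<le> x \<and> x \<le> b \<and> c * x + d \<le> y \<and> y \<le> e * x + h}"
  shows "R \<in> fmeasurable lborel" "measure lborel R = (e - c) * (b\<^sup>2 - a\<^sup>2) / 2 + (h - d) * (b - a)"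
proof -
  have "closed R"
    unfolding R_def case_prod_unfold
    by (intro closed_Collect_conj closed_Collect_le continuous_intros)
  then have sets: "R \<in> sets lborel" by (simp add: borel_closed)
  let ?F = "\<lambda>x. (e - c) * x\<^sup>2 / 2 + (h - d) * x"
  have "emeasure lborel R = emeasure (lborel \<Otimes>\<^sub>M lborel) R" by (simp add: lborel_prod)
  also have "\<dots> = (\<integral>\<^sup>+ x. emeasure lborel (Pair x -` R) \<partial>lborel)"
    by (rule lborel.emeasure_pair_measure_alt) (use sets in \<open>simp only: lborel_prod\<close>)
  also have "\<dots> = (\<integral>\<^sup>+ x. ennreal ((e * x + h) - (c * x + d)) * indicator {a..b} x \<partial>lborel)"
  proof (rule nn_integral_cong)
    fix x :: real
    have "Pair x -` R = (if x \<in> {a..b} then {c * x + d..e * x + h} else {})" by (auto simp: R_def)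
    then show "emeasure lborel (Pair x -` R) = ennreal ((e * x + h) - (c * x + d)) * indicator {a..b} x"
      using le[of x] by auto
  qed
  also have "\<dots> = ennreal (?F b - ?F a)"
  proof (rule nn_integral_FTC_Icc)
    show "DERIV ?F x :> (e * x + h) - (c * x + d)" for x
      by (auto intro!: derivative_eq_intros simp: field_simps)
  qed (use assms in auto)
  finally have em: "emeasure lborel R = ennreal (?F b - ?F a)" .
  have nn: "0 \<le> ?F b - ?F a"
  proof -
    have "\<exists>D. (?F has_real_derivative D) (at x) \<and> 0 \<le> D" if "a \<le> x" "x \<le> b" for x
      using le[OF that] by (intro exI[of _ "(e * x + h) - (c * x + d)"])
        (auto intro!: derivative_eq_intros simp: field_simps)
    then show ?thesis using DERIV_nonneg_imp_nondecreasing[OF \<open>a \<le> b\<close>, of ?F] by simp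
  qed
  show "R \<in> fmeasurable lborel" using sets em by (intro fmeasurableI) auto
  show "measure lborel R = (e - c) * (b\<^sup>2 - a\<^sup>2) / 2 + (h - d) * (b - a)"
    using em nn by (simp add: measure_def enn2real_ennreal field_simps)
qed

text \<open>Regions of successive steps share at most a vertical line; this makes their areas add up.\<close>

lemma AE_not_vertical: "AE p in (lborel :: (real \<times> real) measure). fst p \<noteq> c"
proof -
  have "emeasure (lborel \<Otimes>\<^sub>M lborel) ({c} \<times> (UNIV :: real set)) = emeasure lborel {c} * emeasure lborel (UNIV :: real set)"
    by (rule lborel.emeasure_pair_measure_Times) auto
  then have "{c} \<times> (UNIV :: real set) \<in> null_sets (lborel :: (real \<times> real) measure)"
    by (intro null_setsI) (auto simp: lborel_prod intro!: borel_closed closed_Times)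
  then show ?thesis by (rule AE_I') auto
qed

lemma measure_vertical_segment:
  fixes c a b :: real
  shows "{c} \<times> {a..b} \<in> fmeasurable lborel" "measure lborel ({c} \<times> {a..b}) = 0"
proof -
  have "closed ({c} \<times> {a..b})" by (intro closed_Times) auto
  then have sets: "{c} \<times> {a..b} \<in> sets lborel" by (simp add: borel_closed)
  have "{c} \<times> {a..b} \<in> null_sets lborel"
    by (rule iffD2[OF AE_iff_null_sets[OF sets]])
      (use AE_not_vertical[of c] in \<open>auto elim!: eventually_mono\<close>)
  then have "emeasure lborel ({c} \<times> {a..b}) = 0" by auto
  then show "{c} \<times> {a..b} \<in> fmeasurable lborel" "measure lborel ({c} \<times> {a..b}) = 0"
    using sets by (auto intro: fmeasurableI simp: measure_def)
qed

lemma below_line_segment: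
  fixes x0 y0 :: nat
  assumes n: "n \<ge> 1" and d: "d \<noteq> Up"
    and le: "\<And>x y. (x, y) \<in> closed_segment (embed (x0, y0)) (embed (move (x0, y0) d)) \<Longrightarrow> y \<le> real m * x / real n"
  defines "R \<equiv> below_line m n (closed_segment (embed (x0, y0)) (embed (move (x0, y0) d)))"
  shows "R \<in> fmeasurable lborel"
    and "measure lborel R = (real m / n - north d) * ((real x0 + 1)\<^sup>2 - (real x0)\<^sup>2) / 2
      + (north d * real x0 - real y0)"
    and "R \<subseteq> {p. fst p \<le> real x0 + 1}"
proof -
  let ?k = "real_of_int (north d)"
  have mv: "embed (move (x0, y0) d) = (real x0 + 1, real y0 + ?k)"
    using d by (cases d) (auto simp: embed_def)
  have seg: "(x, y) \<in> closed_segment (embed (x0, y0)) (embed (move (x0, y0) d)) \<longleftrightarrow>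
      real x0 \<le> x \<and> x \<le> real x0 + 1 \<and> y = ?k * x + (real y0 - ?k * real x0)" for x y
  proof
    assume "(x, y) \<in> closed_segment (embed (x0, y0)) (embed (move (x0, y0) d))"
    then obtain u where u: "0 \<le> u" "u \<le> 1" "(x, y) = (1 - u) *\<^sub>R embed (x0, y0) + u *\<^sub>R embed (move (x0, y0) d)"
      by (auto simp: closed_segment_def)
    then have "x = real x0 + u" "y = real y0 + u * ?k"
      unfolding mv by (simp_all add: embed_def algebra_simps)
    then show "real x0 \<le> x \<and> x \<le> real x0 + 1 \<and> y = ?k * x + (real y0 - ?k * real x0)"
      using u by (simp add: algebra_simps)
  next
    assume a: "real x0 \<le> x \<and> x \<le> real x0 + 1 \<and> y = ?k * x + (real y0 - ?k * real x0)"
    show "(x, y) \<in> closed_segment (embed (x0, y0)) (embed (move (x0, y0) d))"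
      unfolding closed_segment_def mv mem_Collect_eq
      by (rule exI[of _ "x - real x0"]) (use a in \<open>simp add: embed_def algebra_simps\<close>)
  qed
  have le': "?k * x + (real y0 - ?k * real x0) \<le> real m / real n * x + 0"
    if "real x0 \<le> x" "x \<le> real x0 + 1" for x
    using le[of x "?k * x + (real y0 - ?k * real x0)"] seg that by simp
  have R: "R = {(x, y). real x0 \<le> x \<and> x \<le> real x0 + 1 \<and> ?k * x + (real y0 - ?k * real x0) \<le> y
      \<and> y \<le> real m / real n * x + 0}"
    unfolding R_def below_line_def seg by auto
  show "R \<in> fmeasurable lborel" unfolding R
    by (rule measure_between_lines) (use le' in auto)
  have "measure lborel R = (real m / real n - ?k) * ((real x0 + 1)\<^sup>2 - (real x0)\<^sup>2) / 2
      + (0 - (real y0 - ?k * real x0)) * ((real x0 + 1) - real x0)" unfolding R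
    by (rule measure_between_lines) (use le' in auto)
  then show "measure lborel R = (real m / n - north d) * ((real x0 + 1)\<^sup>2 - (real x0)\<^sup>2) / 2
      + (north d * real x0 - real y0)" by simp
  show "R \<subseteq> {p. fst p \<le> real x0 + 1}" unfolding R by auto
qed

lemma trace_from_right: "q \<in> trace_from p w \<Longrightarrow> real (fst p) \<le> fst q"
proof (induction w arbitrary: p)
  case Nil
  then show ?case by (simp add: embed_def)
next
  case (Cons d w)
  obtain x y where p: "p = (x, y)" by (cases p)
  have mv: "x \<le> fst (move p d)" unfolding p by (cases d) auto
  from Cons.prems consider "q \<in> closed_segment (embed p) (embed (move p d))" | "q \<in> trace_from (move p d) w" by auto
  then show ?case
  proof cases
    case 1
    then obtain u where u: "0 \<le> u" "u \<le> 1" "q = (1 - u) *\<^sub>R embed p + u *\<^sub>R embed (move p d)"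
      by (auto simp: closed_segment_def)
    have "fst q = (1 - u) * real x + u * real (fst (move p d))" using u(3) p by (simp add: embed_def)
    also have "\<dots> \<ge> (1 - u) * real x + u * real x" using u mv by (intro add_left_mono mult_left_mono) auto
    finally show ?thesis using p by (simp add: algebra_simps)
  next
    case 2
    then show ?thesis using Cons.IH[OF 2] mv p by (simp add: order_trans[rotated])
  qed
qed

text \<open>The region is the area under the line minus the area under the path. The former is
  \<open>m (x'\<^sup>2 - x\<^sup>2) / 2n\<close>, and the integral of \<open>y dx\<close> along the path is expressed by that of \<open>x dy - y dx\<close>,
  whose value is \<open>sweep\<close> corrected for the starting point \<open>p\<close>, using that \<open>x dy + y dx\<close> is exact.
  The factor \<open>2n\<close> clears denominators.\<close>

lemma measure_below_line_trace:
  assumes n: "n \<ge> 1"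
    and le: "\<And>x y. (x, y) \<in> trace_from p w \<Longrightarrow> y \<le> real m * x / real n"
  shows "below_line m n (trace_from p w) \<in> fmeasurable lborel \<and>
    2 * real n * measure lborel (below_line m n (trace_from p w))
     = real m * ((real (fst p) + width w)\<^sup>2 - (real (fst p))\<^sup>2)
       - real n * ((real (fst p) + width w) * (real (snd p) + height w) - real (fst p) * real (snd p))
       + real n * (sweep w + real (fst p) * height w - real (snd p) * width w)"
  using le
proof (induction w arbitrary: p)
  case Nil
  obtain x0 y0 where p: "p = (x0, y0)" by (cases p)
  have "below_line m n (trace_from p []) = {real x0} \<times> {real y0..real m * real x0 / real n}"
    by (auto simp: below_line_def p embed_def)
  then show ?case using measure_vertical_segment by simp
next
  case (Cons d w)
  obtain x0 y0 where p: "p = (x0, y0)" by (cases p)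
  let ?S = "closed_segment (embed p) (embed (move p d))"
  let ?T = "trace_from (move p d) w"
  have T: "below_line m n ?T \<in> fmeasurable lborel"
     "2 * real n * measure lborel (below_line m n ?T)
     = real m * ((real (fst (move p d)) + width w)\<^sup>2 - (real (fst (move p d)))\<^sup>2)
       - real n * ((real (fst (move p d)) + width w) * (real (snd (move p d)) + height w)
           - real (fst (move p d)) * real (snd (move p d)))
       + real n * (sweep w + real (fst (move p d)) * height w - real (snd (move p d)) * width w)"
    using Cons.IH[of "move p d"] Cons.prems by auto
  have Tr: "fst q \<ge> real (fst (move p d))" if "q \<in> below_line m n ?T" for q
    using that trace_from_right[of _ "move p d" w] by (auto simp: below_line_def)
  have un: "below_line m n (trace_from p (d # w)) = below_line m n ?S \<union> below_line m n ?T"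
    by (simp add: below_line_Un)
  show ?case
  proof (cases "d = Up")
    case True
    have seg: "q \<in> ?S \<longleftrightarrow> fst q = real x0 \<and> real y0 \<le> snd q \<and> snd q \<le> real y0 + 1" for q
    proof
      assume "q \<in> ?S"
      then show "fst q = real x0 \<and> real y0 \<le> snd q \<and> snd q \<le> real y0 + 1"
        unfolding p True by (auto simp: closed_segment_def embed_def algebra_simps)
    next
      assume "fst q = real x0 \<and> real y0 \<le> snd q \<and> snd q \<le> real y0 + 1"
      then show "q \<in> ?S"
        unfolding p True closed_segment_def mem_Collect_eq
        by (intro exI[of _ "snd q - real y0"]) (auto simp: embed_def prod_eq_iff algebra_simps)
    qed
    have S: "below_line m n ?S = {real x0} \<times> {real y0..real m * real x0 / real n}"
    proof (rule set_eqI)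
      fix q :: "real \<times> real"
      obtain x y where q: "q = (x, y)" by (cases q)
      show "q \<in> below_line m n ?S \<longleftrightarrow> q \<in> {real x0} \<times> {real y0..real m * real x0 / real n}"
        unfolding below_line_def seg q
        by (auto intro!: exI[of _ "real y0"])
    qed
    have "AE q in lborel. q \<notin> below_line m n ?S \<or> q \<notin> below_line m n ?T"
      using AE_not_vertical[of "real x0"] by eventually_elim (auto simp: S)
    then have meas: "measure lborel (below_line m n ?S \<union> below_line m n ?T)
        = measure lborel (below_line m n ?S) + measure lborel (below_line m n ?T)"
      by (rule measure_Un_AE) (use S T measure_vertical_segment in auto)
    have mv: "fst (move p d) = x0" "real (snd (move p d)) = real y0 + 1"
      unfolding p True by simp_all
    have 0: "below_line m n ?S \<in> fmeasurable lborel" "measure lborel (below_line m n ?S) = 0"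
      unfolding S by (rule measure_vertical_segment)+
    show ?thesis
      unfolding un meas distrib_left T(2) mv width.simps height.simps sweep.simps 0(2)
      using 0(1) T(1) unfolding p True by (simp add: algebra_simps power2_eq_square fmeasurable.Un)
  next
    case False
    have S: "below_line m n ?S \<in> fmeasurable lborel"
      "measure lborel (below_line m n ?S) = (real m / n - north d) * ((real x0 + 1)\<^sup>2 - (real x0)\<^sup>2) / 2
      + (north d * real x0 - real y0)"
      "below_line m n ?S \<subseteq> {p. fst p \<le> real x0 + 1}"
      using below_line_segment[OF n False, of x0 y0 m] Cons.prems unfolding p by auto
    have mv: "fst (move p d) = x0 + 1" "real (snd (move p d)) = real y0 + north d"
      using False unfolding p by (cases d; simp)+
    have ed: "east d = 1" using False by (cases d) auto
    have "AE q in lborel. q \<notin> below_line m n ?S \<or> q \<notin> below_line m n ?T"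
      using AE_not_vertical[of "real x0 + 1"]
    proof eventually_elim
      case (elim q)
      then show ?case using S(3) Tr[of q] mv by force
    qed
    then have meas: "measure lborel (below_line m n ?S \<union> below_line m n ?T)
        = measure lborel (below_line m n ?S) + measure lborel (below_line m n ?T)"
      by (rule measure_Un_AE) (use S T in auto)
    have "2 * real n * measure lborel (below_line m n ?S)
      = (real m - real n * north d) * ((real x0 + 1)\<^sup>2 - (real x0)\<^sup>2)
       + 2 * real n * (north d * real x0 - real y0)"
      unfolding S(2) using n by (simp add: field_simps)
    then show ?thesis
      unfolding un meas distrib_left T(2) mv width.simps height.simps sweep.simps ed
      using S(1) T(1) unfolding p by (simp add: algebra_simps power2_eq_square fmeasurable.Un)
  qed
qed

section \<open>Coefficients of the generating functions\<close>

lemma last_visited_from: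
  "int (fst (last (visited_from q w))) = int (fst q) + width w \<and>
   int (snd (last (visited_from q w))) = int (snd q) + height w"
proof (induction w arbitrary: q)
  case (Cons d w)
  obtain x y where q: "q = (x, y)" by (cases q)
  have ne: "visited_from v w \<noteq> []" for v by (cases w) auto
  show ?case using Cons.IH[of "move q d"] unfolding q by (cases d) (auto simp: ne)
qed simp

lemma ex_split_Cons:
  "(\<exists>p r. d # w = p @ r \<and> P p) \<longleftrightarrow> P [] \<or> (\<exists>p r. w = p @ r \<and> P (d # p))"
proof
  assume "\<exists>p r. d # w = p @ r \<and> P p"
  then show "P [] \<or> (\<exists>p r. w = p @ r \<and> P (d # p))" by (auto simp: Cons_eq_append_conv)
next
  assume "P [] \<or> (\<exists>p r. w = p @ r \<and> P (d # p))"
  then show "\<exists>p r. d # w = p @ r \<and> P p"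
  proof
    assume "P []"
    then have "d # w = [] @ (d # w) \<and> P []" by simp
    then show ?thesis by blast
  next
    assume "\<exists>p r. w = p @ r \<and> P (d # p)"
    then obtain p r where "w = p @ r" "P (d # p)" by blast
    then have "d # w = (d # p) @ r \<and> P (d # p)" by simp
    then show ?thesis by blast
  qed
qed

lemma set_visited_from:
  "v \<in> set (visited_from q w) \<longleftrightarrow>
    (\<exists>p r. w = p @ r \<and> int (fst v) = int (fst q) + width p \<and> int (snd v) = int (snd q) + height p)"
proof (induction w arbitrary: q)
  case Nil
  then show ?case by (auto simp: prod_eq_iff)
next
  case (Cons d w)
  obtain x y where q: "q = (x, y)" by (cases q)
  have mv: "int (fst (move q d)) = int (fst q) + east d" "int (snd (move q d)) = int (snd q) + north d"
    unfolding q by (cases d; simp)+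
  have "v \<in> set (visited_from q (d # w)) \<longleftrightarrow> v = q \<or> v \<in> set (visited_from (move q d) w)" by simp
  also have "\<dots> \<longleftrightarrow> (\<exists>p r. d # w = p @ r \<and> int (fst v) = int (fst q) + width p \<and> int (snd v) = int (snd q) + height p)"
    unfolding Cons.IH mv ex_split_Cons by (auto simp: prod_eq_iff add.assoc)
  finally show ?case .
qed

text \<open>The half-plane under the line is convex, so it contains a segment as soon as it contains its end points.\<close>

lemma trace_below_iff:
  assumes n: "n \<ge> 1"
  shows "(\<forall>(x, y)\<in>trace_from q w. y \<le> real m * x / real n) \<longleftrightarrow>
    (\<forall>v\<in>set (visited_from q w). real (snd v) \<le> real m * real (fst v) / real n)"
proof (induction w arbitrary: q)
  case Nil
  then show ?case by (simp add: embed_def)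
next
  case (Cons d w)
  let ?H = "{p :: real \<times> real. snd p \<le> real m * fst p / real n}"
  have H: "?H = {p. inner (- real m / real n, 1) p \<le> 0}"
    by (auto simp: inner_prod_def)
  have "convex ?H" unfolding H by (rule convex_halfspace_le)
  moreover have "embed (move q d) \<in> ?H" if "\<forall>v\<in>set (visited_from (move q d) w). real (snd v) \<le> real m * real (fst v) / real n"
    using that by (cases w) (auto simp: embed_def)
  ultimately have seg: "closed_segment (embed q) (embed (move q d)) \<subseteq> ?H \<longleftrightarrow> embed q \<in> ?H"
    if "\<forall>v\<in>set (visited_from (move q d) w). real (snd v) \<le> real m * real (fst v) / real n"
    using that closed_segment_subset[of "embed q" ?H "embed (move q d)"] by auto
  have "(\<forall>(x, y)\<in>trace_from q (d # w). y \<le> real m * x / real n) \<longleftrightarrow>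
      closed_segment (embed q) (embed (move q d)) \<subseteq> ?H \<and>
      (\<forall>(x, y)\<in>trace_from (move q d) w. y \<le> real m * x / real n)"
    by (auto simp: case_prod_unfold)
  also have "\<dots> \<longleftrightarrow> embed q \<in> ?H \<and>
      (\<forall>v\<in>set (visited_from (move q d) w). real (snd v) \<le> real m * real (fst v) / real n)"
    unfolding Cons.IH using seg by blast
  also have "\<dots> \<longleftrightarrow> (\<forall>v\<in>set (visited_from q (d # w)). real (snd v) \<le> real m * real (fst v) / real n)"
    by (simp add: embed_def)
  finally show ?case .
qed

lemma below_iff_level:
  fixes x y :: nat
  assumes n: "n \<ge> 1"
  shows "real y \<le> (real m * real x - real s) / real n \<longleftrightarrow> int s \<le> int m * int x - int n * int y"
proof -
  have "real y \<le> (real m * real x - real s) / real n \<longleftrightarrow> real_of_int (int s) \<le> real_of_int (int m * int x - int n * int y)"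
    using n by (simp add: field_simps)
  then show ?thesis by (simp only: of_int_le_iff)
qed

lemma visited_split:
  assumes "w = p @ r"
  shows "(nat (width p), nat (height p)) \<in> set (visited w)"
  unfolding set_visited_from
  by (intro exI[of _ p] exI[of _ r]) (use assms in \<open>auto simp: width_nonneg height_nonneg\<close>)

lemma schroeder_paths_iff:
  assumes n: "n \<ge> 1"
  shows "w \<in> schroeder_paths m n l \<longleftrightarrow> width w = int (n * l) \<and> height w = int (m * l) \<and>
    (\<forall>p r. w = p @ r \<longrightarrow> 0 \<le> level m n p)"
proof -
  have "last (visited w) = (n * l, m * l) \<longleftrightarrow> width w = int (n * l) \<and> height w = int (m * l)"
    using last_visited_from[of "(0, 0)" w]
    by (simp only: prod_eq_iff fst_conv snd_conv of_nat_eq_iff[symmetric, where ?'a = int]) auto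
  moreover have "(\<forall>v\<in>set (visited w). real (snd v) \<le> real m * real (fst v) / real n) \<longleftrightarrow>
    (\<forall>p r. w = p @ r \<longrightarrow> 0 \<le> level m n p)"
  proof
    assume L: "\<forall>v\<in>set (visited w). real (snd v) \<le> real m * real (fst v) / real n"
    show "\<forall>p r. w = p @ r \<longrightarrow> 0 \<le> level m n p"
    proof (intro allI impI)
      fix p r assume "w = p @ r"
      from L[rule_format, OF visited_split[OF this]]
      show "0 \<le> level m n p"
        using below_iff_level[OF n, of "nat (height p)" m "nat (width p)" 0]
        by (simp add: level_def width_nonneg height_nonneg)
    qed
  next
    assume R: "\<forall>p r. w = p @ r \<longrightarrow> 0 \<le> level m n p"
    show "\<forall>v\<in>set (visited w). real (snd v) \<le> real m * real (fst v) / real n"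
    proof
      fix v assume "v \<in> set (visited w)"
      then obtain p r where "w = p @ r" "int (fst v) = width p" "int (snd v) = height p"
        unfolding set_visited_from by auto
      then show "real (snd v) \<le> real m * real (fst v) / real n"
        using R below_iff_level[OF n, of "snd v" m "fst v" 0] by (simp add: level_def)
    qed
  qed
  ultimately show ?thesis
    unfolding schroeder_paths_def mem_Collect_eq trace_below_iff[OF n] by blast
qed

text \<open>At the end point \<open>(n l, m l)\<close> the first two terms of \<open>measure_below_line_trace\<close> cancel.\<close>

lemma path_area_sweep:
  assumes n: "n \<ge> 1" and w: "w \<in> schroeder_paths m n l"
  shows "2 * path_area m n w = sweep w"
proof -
  have le: "y \<le> real m * x / real n" if "(x, y) \<in> trace w" for x y
    using w that by (auto simp: schroeder_paths_def)
  have dims: "width w = int (n * l)" "height w = int (m * l)"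
    using w unfolding schroeder_paths_iff[OF n] by auto
  have "2 * real n * path_area m n w = real n * sweep w"
    using measure_below_line_trace[OF n, of "(0, 0)" w m, OF le] unfolding dims
    by (simp add: path_area_def region_below_line_def below_line_def power2_eq_square)
  then show ?thesis using n by simp
qed

lemma counted_paths_eq:
  assumes n: "n \<ge> 1"
  shows "counted_paths m n s i j l
    = {w \<in> paths m n (int s) l. 2 * count_list w Diag = i \<and> sweep w = int j}"
proof -
  have mid: "(\<forall>(x, y) \<in> midway_points m n l w. real y \<le> (real m * real x - real s) / real n) \<longleftrightarrow>
    (\<forall>p r. w = p @ r \<longrightarrow> width p \<noteq> int (n * l) \<and> height p \<noteq> 0 \<longrightarrow> int s \<le> level m n p)" (is "?L \<longleftrightarrow> ?R") for w
  proof
    assume L: ?L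
    show ?R
    proof (intro allI impI)
      fix p r assume eq: "w = p @ r" and ne: "width p \<noteq> int (n * l) \<and> height p \<noteq> 0"
      have "(nat (width p), nat (height p)) \<in> midway_points m n l w"
        using visited_split[OF eq] ne width_nonneg[of p] height_nonneg[of p]
        by (auto simp: midway_points_def nat_eq_iff)
      with L have "real (nat (height p)) \<le> (real m * real (nat (width p)) - real s) / real n" by blast
      then show "int s \<le> level m n p"
        unfolding below_iff_level[OF n] by (simp add: level_def width_nonneg height_nonneg)
    qed
  next
    assume R: ?R
    show ?L
    proof clarify
      fix x y assume "(x, y) \<in> midway_points m n l w"
      then have v: "(x, y) \<in> set (visited w)" and "x \<noteq> n * l" "y \<noteq> 0" by (auto simp: midway_points_def)
      from v obtain p r where "w = p @ r" "int x = width p" "int y = height p"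
        unfolding set_visited_from by auto
      moreover have "width p \<noteq> int (n * l)" using \<open>int x = width p\<close> \<open>x \<noteq> n * l\<close> by (metis of_nat_eq_iff)
      moreover have "height p \<noteq> 0" using \<open>int y = height p\<close> \<open>y \<noteq> 0\<close> by simp
      ultimately show "real y \<le> (real m * real x - real s) / real n"
        unfolding below_iff_level[OF n] using R by (simp add: level_def)
    qed
  qed
  have ij: "real (count_list w Diag) = real i / 2 \<longleftrightarrow> 2 * count_list w Diag = i" for w
    by (simp add: field_simps flip: of_nat_eq_iff[where ?'a = real])
  have ar: "path_area m n w = real j / 2 \<longleftrightarrow> sweep w = int j" if "w \<in> schroeder_paths m n l" for w
  proof -
    have "path_area m n w = real j / 2 \<longleftrightarrow> real_of_int (sweep w) = real_of_int (int j)"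
      using path_area_sweep[OF n that] by (auto simp: field_simps)
    then show ?thesis by (simp only: of_int_eq_iff)
  qed
  show ?thesis
    unfolding counted_paths_def paths_def mid ij using ar schroeder_paths_iff[OF n] by blast
qed

text \<open>The paths of size \<open>l\<close> are sorted by their two exponents.\<close>

lemma nth_schroeder_gf:
  assumes n: "n \<ge> 1"
  shows "fps_nth (schroeder_gf m n s) l = path_sum m n s l"
proof (cases "s > m * n * l")
  case True
  then show ?thesis by (simp add: schroeder_gf_def path_sum_def schroeder_number_def)
next
  case False
  let ?P = "paths m n (int s) l"
  define f where "f w = (2 * count_list w Diag, nat (sweep w))" for w
  have nn: "0 \<le> sweep w" if "w \<in> ?P" for w
  proof -
    have "w \<in> schroeder_paths m n l" using that unfolding schroeder_paths_iff[OF n] paths_def by blast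
    then have "real_of_int (sweep w) = 2 * path_area m n w" using path_area_sweep[OF n] by simp
    also have "\<dots> \<ge> 0" by (simp add: path_area_def)
    finally show ?thesis by simp
  qed
  have num: "schroeder_number m n s i j l = card {w \<in> ?P. f w = (i, j)}" for i j
  proof -
    have "{w \<in> ?P. 2 * count_list w Diag = i \<and> sweep w = int j} = {w \<in> ?P. f w = (i, j)}"
      using nn by (auto simp: f_def)
    then show ?thesis using False by (simp add: schroeder_number_def counted_paths_eq[OF n])
  qed
  have supp: "{(i, j). schroeder_number m n s i j l \<noteq> 0} = f ` ?P"
  proof -
    have "card {w \<in> ?P. f w = x} \<noteq> 0 \<longleftrightarrow> x \<in> f ` ?P" for x
      using finite_paths[of m n "int s" l] by (auto simp: card_eq_0_iff)
    then show ?thesis unfolding num by auto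
  qed
  have "sum wt ?P = (\<Sum>x\<in>f ` ?P. \<Sum>w\<in>{w \<in> ?P. f w = x}. wt w)"
    by (rule sum.image_gen[OF finite_paths])
  also have "\<dots> = (\<Sum>(i, j)\<in>f ` ?P. of_nat (schroeder_number m n s i j l) * avar ^ i * qpow (int j))"
  proof (rule sum.cong[OF refl], clarify)
    fix i j
    have "(\<Sum>w\<in>{w \<in> ?P. f w = (i, j)}. wt w) = (\<Sum>w\<in>{w \<in> ?P. f w = (i, j)}. avar ^ i * qpow (int j))"
      by (rule sum.cong) (use nn in \<open>auto simp: wt_def f_def\<close>)
    then show "(\<Sum>w\<in>{w \<in> ?P. f w = (i, j)}. wt w) = of_nat (schroeder_number m n s i j l) * avar ^ i * qpow (int j)"
      unfolding num by (simp add: mult.assoc)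
  qed
  also have "\<dots> = fps_nth (schroeder_gf m n s) l"
    by (simp only: schroeder_gf_def fps_nth_Abs_fps supp)
  finally show ?thesis using False by (simp add: path_sum_def)
qed

section \<open>Residues\<close>

lemma alpha_spec:
  assumes "n \<ge> 1" "coprime m n"
  shows "alpha m n s < n" "[alpha m n s * m = s] (mod n)"
  using theI'[OF ex1_residue[OF assms]] unfolding alpha_def by auto

lemma beta_spec:
  assumes "m \<ge> 1" "coprime m n"
  shows "beta m n s < m" "[beta m n s * n = s] (mod m)"
  using theI'[OF ex1_residue[of m n s]] assms unfolding beta_def by (auto simp: coprime_commute)

lemma residue_index_le:
  assumes "m \<ge> 1" "n \<ge> 1" "coprime m n"
  shows "beta m n s * n + 1 \<le> m * n" "alpha m n s * m + 1 \<le> m * n"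
proof -
  have "beta m n s * n < m * n" using beta_spec(1)[of m n s] assms by simp
  then show "beta m n s * n + 1 \<le> m * n" by linarith
  have "alpha m n s * m < n * m" using alpha_spec(1)[of n m s] assms by simp
  then show "alpha m n s * m + 1 \<le> m * n" by (simp only: mult.commute[of n m])
qed

text \<open>Each of \<open>m\<close> and \<open>n\<close> divides the numerator, which lies strictly between \<open>- m n\<close> and \<open>2 m n\<close>.\<close>

lemma epsilon_spec:
  assumes m: "m \<ge> 1" and n: "n \<ge> 1" and co: "coprime m n" and s: "0 < s" "s < m * n"
  shows "int (m * n) dvd epsilon_num m n s"
    and "epsilon m n s = 0 \<or> epsilon m n s = 1"
    and "int s = int (alpha m n s) * int m + int (beta m n s) * int n - int (m * n) * epsilon m n s"
proof -
  let ?a = "alpha m n s" and ?b = "beta m n s"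
  have "int n dvd int (?a * m) - int s"
    using alpha_spec(2)[OF n co, of s] by (simp add: cong_iff_dvd_diff flip: cong_int_iff)
  then have "int n dvd (int (?a * m) - int s) + int (?b * n)" by (rule dvd_add) simp
  then have dn: "int n dvd epsilon_num m n s" by (simp add: epsilon_num_def algebra_simps)
  have "int m dvd int (?b * n) - int s"
    using beta_spec(2)[OF m co, of s] by (simp add: cong_iff_dvd_diff flip: cong_int_iff)
  then have "int m dvd (int (?b * n) - int s) + int (?a * m)" by (rule dvd_add) simp
  then have dm: "int m dvd epsilon_num m n s" by (simp add: epsilon_num_def algebra_simps)
  have "coprime (int m) (int n)" using co by simp
  then show dvd: "int (m * n) dvd epsilon_num m n s" using divides_mult[OF dm dn] by simp
  then have eq: "epsilon_num m n s = int (m * n) * epsilon m n s" by (simp add: epsilon_def)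
  show "int s = int ?a * int m + int ?b * int n - int (m * n) * epsilon m n s"
    unfolding eq[symmetric] by (simp add: epsilon_num_def)
  have "?a * m \<le> n * m" "?b * n \<le> m * n"
    using alpha_spec(1)[OF n co, of s] beta_spec(1)[OF m co, of s] by simp_all
  then have "int (?a * m) \<le> int (m * n)" "int (?b * n) \<le> int (m * n)"
    by (simp_all only: of_nat_le_iff mult.commute)
  then have "epsilon_num m n s < int (m * n) * 2"
    using s unfolding epsilon_num_def by linarith
  then have e2: "epsilon m n s < 2" unfolding eq by (simp add: mult_less_cancel_left)
  have "int s < int (m * n)" using s by (simp only: of_nat_less_iff)
  then have "int (m * n) * (- 1) < epsilon_num m n s" unfolding epsilon_num_def by linarith
  then have "- 1 < epsilon m n s" unfolding eq by (simp only: mult_less_cancel_left)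
  then show "epsilon m n s = 0 \<or> epsilon m n s = 1" using e2 by auto
qed

section \<open>The equations in terms of coefficients\<close>

lemma nth_qsubst: "fps_nth (qsubst k f) l = qpow k ^ l * fps_nth f l"
  by (simp add: qsubst_def)

text \<open>Multiplication by \<open>x\<^sup>-\<^sup>e\<close> shifts coefficients, and the product remains a power series because its lowest
  \<open>e\<close> coefficients vanish.\<close>

lemma fls_equation_iff:
  fixes f g a b d :: "'a :: comm_ring_1 fps"
  assumes low: "\<And>i. i < e \<Longrightarrow> fps_nth (a * b * d) i = 0"
  shows "fps_to_fls f = fps_to_fls g + fls_const c * fls_X_intpow (- int e) * fps_to_fls a * fps_to_fls b * fps_to_fls d
    \<longleftrightarrow> (\<forall>l. fps_nth f l = fps_nth g l + c * fps_nth (a * b * d) (l + e))"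
proof -
  have rhs: "fps_to_fls g + fls_const c * fls_X_intpow (- int e) * fps_to_fls a * fps_to_fls b * fps_to_fls d
    = fps_to_fls g + fls_const c * fls_shift (int e) (fps_to_fls (a * b * d))"
  proof -
    have "fls_const c * fls_X_intpow (- int e) * fps_to_fls a * fps_to_fls b * fps_to_fls d
      = fls_const c * (fls_X_intpow (- int e) * fps_to_fls (a * b * d))"
      by (simp only: mult.assoc fls_times_fps_to_fls)
    also have "\<dots> = fls_const c * fls_shift (int e) (fps_to_fls (a * b * d))"
      unfolding fls_X_intpow_times_conv_shift(1) by (simp only: minus_minus)
    finally show ?thesis by (rule arg_cong)
  qed
  have nth: "fls_nth (fps_to_fls g + fls_const c * fls_shift (int e) (fps_to_fls (a * b * d))) k
    = (if k < 0 then 0 else fps_nth g (nat k) + c * fps_nth (a * b * d) (nat k + e))" for k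
  proof (cases "k < 0")
    case True
    then have "k + int e < 0 \<or> nat (k + int e) < e" by auto
    then show ?thesis using True low by auto
  next
    case False
    then have "nat (k + int e) = nat k + e" by (simp add: nat_add_distrib)
    then show ?thesis using False by simp
  qed
  show ?thesis
    unfolding rhs fls_eq_iff nth
  proof
    assume L: "\<forall>k. fls_nth (fps_to_fls f) k = (if k < 0 then 0 else fps_nth g (nat k) + c * fps_nth (a * b * d) (nat k + e))"
    show "\<forall>l. fps_nth f l = fps_nth g l + c * fps_nth (a * b * d) (l + e)"
      using L[rule_format, of "int _"] by simp
  qed auto
qed

text \<open>Since \<open>\<epsilon> \<le> 1\<close>, this suffices for the product to be divisible by \<open>x\<^sup>\<epsilon>\<close>.\<close>

lemma nth_product_from_1:
  fixes a b d :: "'a :: comm_ring_1 fps"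
  assumes "fps_nth b 0 = 0" "fps_nth d 0 = 0" "i < 2"
  shows "fps_nth (a * b * d) i = 0"
proof -
  have "i = 0 \<or> i = 1" using assms(3) by auto
  then show ?thesis using assms by (auto simp: fps_mult_nth)
qed

lemma schroeder_initial_zero:
  assumes "schroeder_initial m n Y" "0 < s" "s \<le> m * n"
  shows "fps_nth (Y s) 0 = 0"
  using assms by (cases "s = m * n") (auto simp: schroeder_initial_def)

text \<open>Separates the initial values from the recursion for positive indices.\<close>

lemma nat_eq_cases_iff:
  fixes f :: "nat \<Rightarrow> 'a"
  assumes "f 0 = c"
  shows "(\<forall>l. f l = (if l = 0 then c else g l)) \<longleftrightarrow> (\<forall>l\<ge>1. f l = g l)"
proof
  assume L: "\<forall>l. f l = (if l = 0 then c else g l)"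
  show "\<forall>l\<ge>1. f l = g l"
  proof (intro allI impI)
    fix l :: nat assume "1 \<le> l"
    then show "f l = g l" using L[rule_format, of l] by simp
  qed
next
  assume R: "\<forall>l\<ge>1. f l = g l"
  show "\<forall>l. f l = (if l = 0 then c else g l)"
  proof
    fix l show "f l = (if l = 0 then c else g l)"
      using R assms by (cases "l = 0") simp_all
  qed
qed

text \<open>Both the existence and the uniqueness part work with this form. The initial values enter since they
  make the product of the three factors divisible by \<open>x\<^sup>\<epsilon>\<close> and remove the term with index 0
  from the first equation.\<close>

lemma schroeder_equations_iff:
  assumes m: "m \<ge> 1" and n: "n \<ge> 1" and co: "coprime m n" and init: "schroeder_initial m n Y"
  shows "schroeder_equations m n Y \<longleftrightarrow>
    (\<forall>l\<ge>1. fps_nth (Y 0) l = (\<Sum>k=1..l. fps_nth (Y 1) k * fps_nth (Y 0) (l - k))) \<and>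
    (\<forall>s. 0 < s \<and> s < m * n \<longrightarrow> (\<forall>l. fps_nth (Y s) l = fps_nth (Y (s + 1)) l +
       qpow (int (m * n) * (epsilon m n s)\<^sup>2 - 2 * int (alpha m n s) * int (beta m n s)) *
       fps_nth (qsubst (2 * int s) (Y 0)
         * qsubst (2 * (int s - int (beta m n s * n))) (Y (beta m n s * n + 1))
         * qsubst (2 * (int s - int (alpha m n s * m))) (Y (alpha m n s * m + 1)))
         (l + nat (epsilon m n s)))) \<and>
    (\<forall>l\<ge>1. fps_nth (Y (m * n)) l =
       qpow (int (m * n)) * (qpow (2 * int (m * n)) ^ (l - 1) * fps_nth (Y 0) (l - 1))
       + (if l = 1 then avar\<^sup>2 * qpow (int (m * n) - 1) else 0))"
proof -
  note zero = schroeder_initial_zero[OF init]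
  have one: "fps_nth (Y 0) 0 = 1" using init by (simp add: schroeder_initial_def)
  have mn: "1 \<le> m * n" using m n by simp
  have "Y 0 * (1 - Y 1) = 1 \<longleftrightarrow> Y 0 = 1 + Y 1 * Y 0" by (auto simp: algebra_simps)
  also have "\<dots> \<longleftrightarrow> (\<forall>l. fps_nth (Y 0) l = (if l = 0 then 1 else 0) + (\<Sum>k=0..l. fps_nth (Y 1) k * fps_nth (Y 0) (l - k)))"
    by (simp add: fps_eq_iff fps_mult_nth)
  also have "\<dots> \<longleftrightarrow> (\<forall>l. fps_nth (Y 0) l
      = (if l = 0 then 1 else \<Sum>k=1..l. fps_nth (Y 1) k * fps_nth (Y 0) (l - k)))"
  proof -
    have "(if l = 0 then 1 else 0) + (\<Sum>k=0..l. fps_nth (Y 1) k * fps_nth (Y 0) (l - k))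
        = (if l = 0 then 1 else \<Sum>k=1..l. fps_nth (Y 1) k * fps_nth (Y 0) (l - k))" for l
      using zero[of 1] mn by (subst sum.atLeast_Suc_atMost) auto
    then show ?thesis by presburger
  qed
  also have "\<dots> \<longleftrightarrow> (\<forall>l\<ge>1. fps_nth (Y 0) l = (\<Sum>k=1..l. fps_nth (Y 1) k * fps_nth (Y 0) (l - k)))"
    by (rule nat_eq_cases_iff, rule one)
  finally have first: "Y 0 * (1 - Y 1) = 1 \<longleftrightarrow> \<dots>" .
  have second: "(fps_to_fls (Y s) =
           fps_to_fls (Y (s + 1)) +
           fls_const (qpow (int (m * n) * (epsilon m n s)\<^sup>2 - 2 * int (alpha m n s) * int (beta m n s))) * fls_X_intpow (- epsilon m n s) *
           fps_to_fls (qsubst (2 * int s) (Y 0)) *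
           fps_to_fls (qsubst (2 * (int s - int (beta m n s * n))) (Y (beta m n s * n + 1))) *
           fps_to_fls (qsubst (2 * (int s - int (alpha m n s * m))) (Y (alpha m n s * m + 1)))) \<longleftrightarrow>
     (\<forall>l. fps_nth (Y s) l = fps_nth (Y (s + 1)) l +
       qpow (int (m * n) * (epsilon m n s)\<^sup>2 - 2 * int (alpha m n s) * int (beta m n s)) *
       fps_nth (qsubst (2 * int s) (Y 0)
         * qsubst (2 * (int s - int (beta m n s * n))) (Y (beta m n s * n + 1))
         * qsubst (2 * (int s - int (alpha m n s * m))) (Y (alpha m n s * m + 1)))
         (l + nat (epsilon m n s)))" if s: "0 < s" "s < m * n" for s
  proof -
    have e: "epsilon m n s = int (nat (epsilon m n s))" "nat (epsilon m n s) < 2"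
      using epsilon_spec(2)[OF m n co s] by auto
    have z: "fps_nth (Y (beta m n s * n + 1)) 0 = 0" "fps_nth (Y (alpha m n s * m + 1)) 0 = 0"
      using residue_index_le[OF m n co, of s] by (auto intro!: zero)
    show ?thesis
      by (subst (2) e(1), rule fls_equation_iff, rule nth_product_from_1)
        (use z e(2) in \<open>auto simp: nth_qsubst\<close>)
  qed
  have "Y (m * n) =
       fps_const (avar\<^sup>2 * qpow (int (m * n) - 1)) * fps_X +
       fps_const (qpow (int (m * n))) * fps_X * qsubst (2 * int (m * n)) (Y 0) \<longleftrightarrow>
    (\<forall>l\<ge>1. fps_nth (Y (m * n)) l =
       qpow (int (m * n)) * (qpow (2 * int (m * n)) ^ (l - 1) * fps_nth (Y 0) (l - 1))
       + (if l = 1 then avar\<^sup>2 * qpow (int (m * n) - 1) else 0))" (is "?E \<longleftrightarrow> ?C")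
  proof -
    have "?E \<longleftrightarrow> (\<forall>l. fps_nth (Y (m * n)) l = (if l = 0 then 0 else
       qpow (int (m * n)) * (qpow (2 * int (m * n)) ^ (l - 1) * fps_nth (Y 0) (l - 1))
       + (if l = 1 then avar\<^sup>2 * qpow (int (m * n) - 1) else 0)))"
    proof -
      have "fps_nth (fps_const (avar\<^sup>2 * qpow (int (m * n) - 1)) * fps_X +
       fps_const (qpow (int (m * n))) * fps_X * qsubst (2 * int (m * n)) (Y 0)) l = (if l = 0 then 0 else
       qpow (int (m * n)) * (qpow (2 * int (m * n)) ^ (l - 1) * fps_nth (Y 0) (l - 1))
       + (if l = 1 then avar\<^sup>2 * qpow (int (m * n) - 1) else 0))" for l
        by (simp add: mult.assoc nth_qsubst)
      then show ?thesis unfolding fps_eq_iff by simp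
    qed
    also have "\<dots> \<longleftrightarrow> ?C"
      by (rule nat_eq_cases_iff, rule zero) (use mn in auto)
    finally show ?thesis .
  qed
  note third = this
  show ?thesis
    unfolding schroeder_equations_def Let_def
    by (intro conj_cong first third all_cong1 imp_cong[OF refl] second; elim conjE; assumption)
qed

lemma nth_triple_product:
  fixes a b d :: "'a :: comm_ring_1 fps"
  shows "fps_nth (a * b * d) L
    = (\<Sum>i=0..L. (\<Sum>j=0..i. fps_nth a j * fps_nth b (i - j)) * fps_nth d (L - i))"
  by (simp add: fps_mult_nth)

section \<open>Existence and uniqueness\<close>

lemma schroeder_initial_gf:
  assumes m: "m \<ge> 1" and n: "n \<ge> 1"
  shows "schroeder_initial m n (schroeder_gf m n)"
  using m n
  by (auto simp: schroeder_initial_def nth_schroeder_gf[OF n] path_sum_def paths_size_0 wt_def)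

lemma schroeder_equations_gf:
  assumes m: "m \<ge> 1" and n: "n \<ge> 1" and co: "coprime m n"
  shows "schroeder_equations m n (schroeder_gf m n)"
  unfolding schroeder_equations_iff[OF m n co schroeder_initial_gf[OF m n]]
proof (intro conjI allI impI)
  fix l :: nat assume l: "1 \<le> l"
  show "fps_nth (schroeder_gf m n 0) l
    = (\<Sum>k=1..l. fps_nth (schroeder_gf m n 1) k * fps_nth (schroeder_gf m n 0) (l - k))"
    unfolding nth_schroeder_gf[OF n] by (rule path_sum_first_return[OF m n co l])
  show "fps_nth (schroeder_gf m n (m * n)) l =
       qpow (int (m * n)) * (qpow (2 * int (m * n)) ^ (l - 1) * fps_nth (schroeder_gf m n 0) (l - 1))
       + (if l = 1 then avar\<^sup>2 * qpow (int (m * n) - 1) else 0)"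
    unfolding nth_schroeder_gf[OF n] by (rule path_sum_shifted_line[OF m n l])
next
  fix s l :: nat assume "0 < s \<and> s < m * n"
  then have s: "0 < s" "s < m * n" by auto
  define e where "e = nat (epsilon m n s)"
  have e: "epsilon m n s = int e" using epsilon_spec(2)[OF m n co s] by (auto simp: e_def)
  show "fps_nth (schroeder_gf m n s) l = fps_nth (schroeder_gf m n (s + 1)) l +
       qpow (int (m * n) * (epsilon m n s)\<^sup>2 - 2 * int (alpha m n s) * int (beta m n s)) *
       fps_nth (qsubst (2 * int s) (schroeder_gf m n 0)
         * qsubst (2 * (int s - int (beta m n s * n))) (schroeder_gf m n (beta m n s * n + 1))
         * qsubst (2 * (int s - int (alpha m n s * m))) (schroeder_gf m n (alpha m n s * m + 1)))
         (l + nat (epsilon m n s))"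
    unfolding nth_triple_product nth_qsubst nth_schroeder_gf[OF n] e nat_int
    by (rule path_sum_touching[OF m n co s alpha_spec(1)[OF n co] beta_spec(1)[OF m co]
          epsilon_spec(3)[OF m n co s, unfolded e]])
qed

text \<open>Induction on the order of the coefficient, and inside it downward induction on \<open>s\<close>; the coefficient for
  \<open>s = 0\<close> comes last.\<close>

lemma schroeder_equations_unique:
  assumes m: "m \<ge> 1" and n: "n \<ge> 1" and co: "coprime m n"
    and Y: "schroeder_equations m n Y" "schroeder_initial m n Y"
    and Z: "schroeder_equations m n Z" "schroeder_initial m n Z"
    and s: "s \<le> m * n"
  shows "Y s = Z s"
proof -
  note eqY = iffD1[OF schroeder_equations_iff[OF m n co Y(2)] Y(1)]
  note eqZ = iffD1[OF schroeder_equations_iff[OF m n co Z(2)] Z(1)]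
  note eqY0 = conjunct1[OF eqY] and eqYs = conjunct1[OF conjunct2[OF eqY]]
    and eqYmn = conjunct2[OF conjunct2[OF eqY]]
  note eqZ0 = conjunct1[OF eqZ] and eqZs = conjunct1[OF conjunct2[OF eqZ]]
    and eqZmn = conjunct2[OF conjunct2[OF eqZ]]
  have mn: "1 \<le> m * n" using m n by simp
  note zeroY = schroeder_initial_zero[OF Y(2)] and zeroZ = schroeder_initial_zero[OF Z(2)]
  have "\<forall>s\<le>m * n. fps_nth (Y s) l = fps_nth (Z s) l" for l
  proof (induction l rule: less_induct)
    case (less l)
    note lower = less.IH
    show ?case
    proof (cases "l = 0")
      case True
      have "fps_nth (Y s) 0 = fps_nth (Z s) 0" if "s \<le> m * n" for s
      proof (cases "s = 0")
        case True
        then show ?thesis using Y(2) Z(2) by (simp add: schroeder_initial_def)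
      next
        case False
        then show ?thesis using that by (simp add: zeroY zeroZ)
      qed
      then show ?thesis using True by blast
    next
      case False
      then have l: "1 \<le> l" by simp
      have pos: "fps_nth (Y s) l = fps_nth (Z s) l" if "0 < s" "s \<le> m * n" for s
        using that
      proof (induction "m * n - s" arbitrary: s rule: less_induct)
        case (less s)
        show ?case
        proof (cases "s = m * n")
          case True
          have "fps_nth (Y 0) (l - 1) = fps_nth (Z 0) (l - 1)" using lower[of "l - 1"] l by simp
          then show ?thesis unfolding True eqYmn[rule_format, OF l] eqZmn[rule_format, OF l] by simp
        next
          case False
          then have s: "0 < s" "s < m * n" using less.prems by auto
          define e where "e = nat (epsilon m n s)"
          have e: "epsilon m n s = int e" "e = 0 \<or> e = 1"
            using epsilon_spec(2)[OF m n co s] by (auto simp: e_def)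
          let ?b = "beta m n s * n + 1" and ?a = "alpha m n s * m + 1"
          have le: "?b \<le> m * n" "?a \<le> m * n" using residue_index_le[OF m n co] by auto
          \<comment> \<open>Here \<open>\<beta>n = s + m(n - \<alpha>)\<close> and \<open>\<alpha>m = s + n(m - \<beta>)\<close>.\<close>
          have gt: "s < ?b" "s < ?a" if "e = 1"
          proof -
            have "int s = int (alpha m n s * m) + int (beta m n s * n) - int (m * n)"
              using epsilon_spec(3)[OF m n co s] e(1) that by simp
            then show "s < ?b" "s < ?a" using le by linarith+
          qed
          have agree: "fps_nth (Y t) k = fps_nth (Z t) k"
            if "0 < t" "t \<le> m * n" "k < l \<or> k = l \<and> s < t" for t k
            using that lower[of k] less.hyps[of t] by auto
          have "fps_nth (qsubst c0 (Y 0) * qsubst c1 (Y ?b) * qsubst c2 (Y ?a)) (l + e)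
              = fps_nth (qsubst c0 (Z 0) * qsubst c1 (Z ?b) * qsubst c2 (Z ?a)) (l + e)" for c0 c1 c2
            unfolding nth_triple_product sum_distrib_right
          proof (intro sum.cong refl)
            fix i j assume ij: "i \<in> {0..l + e}" "j \<in> {0..i}"
            show "fps_nth (qsubst c0 (Y 0)) j * fps_nth (qsubst c1 (Y ?b)) (i - j) * fps_nth (qsubst c2 (Y ?a)) (l + e - i)
              = fps_nth (qsubst c0 (Z 0)) j * fps_nth (qsubst c1 (Z ?b)) (i - j) * fps_nth (qsubst c2 (Z ?a)) (l + e - i)"
            proof (cases "i - j = 0 \<or> l + e - i = 0")
              case True
              then show ?thesis
                using zeroY[of ?a] zeroZ[of ?a] zeroY[of ?b] zeroZ[of ?b] le by (auto simp: nth_qsubst)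
            next
              case False
              \<comment> \<open>The three indices add up to \<open>l + e\<close> and the last two are positive, so the first is below \<open>l\<close>;
                the other two are at most \<open>l\<close>, with equality only for \<open>e = 1\<close>.\<close>
              then have "j < l" using ij e(2) by auto
              then have "fps_nth (Y 0) j = fps_nth (Z 0) j" using lower by blast
              moreover have "i - j < l \<or> i - j = l \<and> e = 1" using False ij e(2) by auto
              then have "fps_nth (Y ?b) (i - j) = fps_nth (Z ?b) (i - j)"
                using agree[of ?b "i - j"] le gt by auto
              moreover have "l + e - i < l \<or> l + e - i = l \<and> e = 1" using False ij e(2) by auto
              then have "fps_nth (Y ?a) (l + e - i) = fps_nth (Z ?a) (l + e - i)"
                using agree[of ?a "l + e - i"] le gt by auto
              ultimately show ?thesis by (simp only: nth_qsubst)
            qed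
          qed
          moreover have "fps_nth (Y (s + 1)) l = fps_nth (Z (s + 1)) l" using agree[of "s + 1" l] s by simp
          ultimately show ?thesis
            unfolding eqYs[rule_format, OF conjI[OF s], of l] eqZs[rule_format, OF conjI[OF s], of l] e(1) nat_int
            by simp
        qed
      qed
      have "fps_nth (Y 1) k * fps_nth (Y 0) (l - k) = fps_nth (Z 1) k * fps_nth (Z 0) (l - k)"
        if "k \<in> {1..l}" for k
        using that pos[of 1] lower[of "l - k"] lower[of k] mn by (cases "k = l") auto
      then have "fps_nth (Y 0) l = fps_nth (Z 0) l"
        unfolding eqY0[rule_format, OF l] eqZ0[rule_format, OF l] by (rule sum.cong[OF refl])
      then show ?thesis using pos by (metis neq0_conv)
    qed
  qed
  then show ?thesis using s by (simp add: fps_eq_iff)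
qed

theorem theorem1p1:
  fixes m n :: nat
  assumes "m \<ge> 1" "n \<ge> 1" "coprime m n"
  shows "(\<forall>s. 0 < s \<and> s < m * n \<longrightarrow> int (m * n) dvd epsilon_num m n s) \<and>
    schroeder_equations m n (schroeder_gf m n) \<and>
    schroeder_initial m n (schroeder_gf m n) \<and>
    (\<forall>Y :: nat \<Rightarrow> laurent fps. schroeder_equations m n Y \<and> schroeder_initial m n Y \<longrightarrow>
       (\<forall>s \<le> m * n. Y s = schroeder_gf m n s))"
proof -
  have "\<forall>s. 0 < s \<and> s < m * n \<longrightarrow> int (m * n) dvd epsilon_num m n s"
    using epsilon_spec(1)[OF assms] by blast
  moreover have eqs: "schroeder_equations m n (schroeder_gf m n)"
    by (rule schroeder_equations_gf[OF assms])
  moreover have init: "schroeder_initial m n (schroeder_gf m n)"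
    by (rule schroeder_initial_gf[OF assms(1,2)])
  moreover have "\<forall>Y. schroeder_equations m n Y \<and> schroeder_initial m n Y \<longrightarrow>
       (\<forall>s \<le> m * n. Y s = schroeder_gf m n s)"
    using schroeder_equations_unique[OF assms _ _ eqs init] by blast
  ultimately show ?thesis by blast
qed

end
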